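(* Let $\xi$ be a (locally finite) Poisson point process on $[0,\infty)$ with intensity measure $\mu$, put $\mu_+(t)=\mu((0,t])$ for $t\geq 0$, and let $\mu_+^{-1}(y)=\inf\{x\ge 0:\mu_+(x)\ge y\}$ for $y\ge 0$. Assume that $\mu(\{0\})=1$, that $\mu_+(t_0)<\infty$ for some $t_0>0$, and that $\mu_+(t)>0$ for all $t>0$. Furthermore, assume that the function $t\mapsto\mu_+(t)$ is convex in a neighborhood of zero (in $[0,\infty)$). Then $\xi$ yields an explosive CMJ process if and only if $$\int_0^\varepsilon\frac{\mu_+^{-1}(x)}{x|\log x|}\,\mathrm{d}x<\infty$$ for some $\varepsilon>0$.
   Context: A reproduction point process $\xi$ is a random point measure on $[0,\infty)$ that is locally finite: $\xi[0,t]<\infty$ almost surely for all $t\ge 0$. Its intensity measure is $\mu(B)=\mathbf{E}[\xi(B)]$ for Borel $B$; Poisson point processes may have atoms in their intensity measure (here $\xi\{0\}$ is Poisson distributed with mean $1$). Write $\xi=\sum_{j=1}^N\delta_{X_j}$ with $N=\xi[0,\infty)\in\mathbb{N}_0\cup\{\infty\}$ and $X_j=\inf\{t\ge 0:\xi[0,t]\ge j\}$ ($\inf\varnothing=\infty$). Crump-Mode-Jagers (CMJ) process driven by $\xi$: let $\mathcal{I}=\{\varnothing\}\cup\bigcup_{n\in\mathbb{N}}\mathbb{N}^n$ be the set of labels, and let $(\xi_u)_{u\in\mathcal{I}}$ be i.i.d. copies of $\xi$, with $X_{u,j}$ defined from $\xi_u$ as $X_j$ is from $\xi$. Birth times are $S(\varnothing)=0$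 and $S(uj)=S(u)+X_{u,j}$ for $u\in\mathcal{I}$, $j\in\mathbb{N}$ (individuals with $S(u)=\infty$ are never born). Let $\mathcal{Z}_t=\#\{u\in\mathcal{I}:S(u)\le t\}$ and let $T=\inf\{t\ge 0:\mathcal{Z}_t=\infty\}\in[0,\infty]$ be the explosion time. One says that $\xi$ yields an explosive CMJ process if $\mathbf{P}(T<\infty)>0$. *)

theory Defs
  imports "HOL-Probability.Probability"
begin

abbreviation half_line :: "real measure" where
  "half_line \<equiv> restrict_space borel {0..}"

text \<open>
  A point measure is a countable sum of Dirac masses. The image under \<open>x\<close> of the counting
  measure on \<open>J\<close> is the sum over \<open>j \<in> J\<close> of the Dirac mass at \<open>x j\<close>, so multiple points
  and infinite total mass are allowed.
\<close>

definition point_measures :: "real measure set" where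
  "point_measures = {distr (count_space J) half_line x | (J :: nat set) x. x \<in> J \<rightarrow> {0..}}"

definition point_measure_algebra :: "real measure measure" where
  "point_measure_algebra =
     sigma point_measures
       {{m \<in> point_measures. emeasure m A \<in> B} | A B. A \<in> sets half_line \<and> B \<in> sets borel}"

definition reproduction_process :: "'a measure \<Rightarrow> ('a \<Rightarrow> real measure) \<Rightarrow> bool" where
  "reproduction_process M \<xi> \<longleftrightarrow>
     \<xi> \<in> measurable M point_measure_algebra \<and>
     (\<forall>t\<ge>0. AE \<omega> in M. emeasure (\<xi> \<omega>) {0..t} < \<infinity>)"

text \<open>
  The mean ranges over \<open>[0,\<infinity>]\<close>, with mean \<open>\<infinity>\<close> giving the constant \<open>\<infinity>\<close>; the library's
  \<open>poisson_pmf\<close> is only available for a strictly positive real mean. For mean 0 the formula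
  gives the constant 0, since \<open>0 ^ 0 = 1\<close>.
\<close>

definition poisson_distributed :: "'a measure \<Rightarrow> ('a \<Rightarrow> ennreal) \<Rightarrow> ennreal \<Rightarrow> bool" where
  "poisson_distributed M X m \<longleftrightarrow>
     X \<in> borel_measurable M \<and>
     (if m = \<infinity> then AE \<omega> in M. X \<omega> = \<infinity>
      else \<forall>k :: nat. measure M {\<omega> \<in> space M. X \<omega> = of_nat k}
                       = enn2real m ^ k / fact k * exp (- enn2real m))"

definition poisson_point_process ::
    "'a measure \<Rightarrow> ('a \<Rightarrow> real measure) \<Rightarrow> real measure \<Rightarrow> bool" where
  "poisson_point_process M \<xi> \<mu> \<longleftrightarrow>
     \<xi> \<in> measurable M point_measure_algebra \<and>
     sets \<mu> = sets half_line \<and>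
     (\<forall>B \<in> sets half_line. poisson_distributed M (\<lambda>\<omega>. emeasure (\<xi> \<omega>) B) (emeasure \<mu> B)) \<and>
     (\<forall>n :: nat. \<forall>B. (\<forall>i<n. B i \<in> sets half_line) \<and> disjoint_family_on B {..<n} \<longrightarrow>
        prob_space.indep_vars M (\<lambda>_. borel) (\<lambda>i \<omega>. emeasure (\<xi> \<omega>) (B i)) {..<n})"

text \<open>
  Labels are words over the positive integers, written with the most recent generation first:
  \<open>j # u\<close> is the \<open>j\<close>-th child of \<open>u\<close>.
\<close>

definition labels :: "nat list set" where
  "labels = lists {1..}"

definition iid_copies ::
    "'b measure \<Rightarrow> (nat list \<Rightarrow> 'b \<Rightarrow> real measure) \<Rightarrow> 'a measure \<Rightarrow> ('a \<Rightarrow> real measure) \<Rightarrow> bool" where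
  "iid_copies P \<Xi> M \<xi> \<longleftrightarrow>
     prob_space.indep_vars P (\<lambda>_. point_measure_algebra) \<Xi> labels \<and>
     (\<forall>u \<in> labels. distr P point_measure_algebra (\<Xi> u) = distr M point_measure_algebra \<xi>)"

text \<open>Times take values in \<open>ennreal\<close>, where the infimum of the empty set is \<open>\<infinity>\<close>.\<close>

definition point_time :: "real measure \<Rightarrow> nat \<Rightarrow> ennreal" where
  "point_time m j = Inf {ennreal t | t. 0 \<le> t \<and> of_nat j \<le> emeasure m {0..t}}"

primrec birth_time :: "(nat list \<Rightarrow> real measure) \<Rightarrow> nat list \<Rightarrow> ennreal" where
  "birth_time x [] = 0"
| "birth_time x (j # u) = birth_time x u + point_time (x u) j"

definition population :: "(nat list \<Rightarrow> real measure) \<Rightarrow> real \<Rightarrow> ennreal" where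
  "population x t = emeasure (count_space UNIV) {u \<in> labels. birth_time x u \<le> ennreal t}"

definition explosion_time :: "(nat list \<Rightarrow> real measure) \<Rightarrow> ennreal" where
  "explosion_time x = Inf {ennreal t | t. 0 \<le> t \<and> population x t = \<infinity>}"

definition explosive_cmj :: "'b measure \<Rightarrow> (nat list \<Rightarrow> 'b \<Rightarrow> real measure) \<Rightarrow> bool" where
  "explosive_cmj P \<Xi> \<longleftrightarrow>
     measure P {\<omega> \<in> space P. explosion_time (\<lambda>u. \<Xi> u \<omega>) < \<infinity>} > 0"

definition mu_plus :: "real measure \<Rightarrow> real \<Rightarrow> ennreal" where
  "mu_plus \<mu> t = emeasure \<mu> {0<..t}"

definition mu_plus_inv :: "real measure \<Rightarrow> real \<Rightarrow> ennreal" where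
  "mu_plus_inv \<mu> y = Inf {ennreal x | x. 0 \<le> x \<and> ennreal y \<le> mu_plus \<mu> x}"

end

theory Submission
  imports Defs
begin

text \<open>
  Let \<open>v t\<close> be the probability that every generation contains an individual born by time \<open>t\<close>.
  Since individuals have finitely many children in bounded time, this is the probability of
  explosion by time \<open>t\<close>. Decomposing at the first generation and using the generating functional
  of the Poisson process, \<open>v\<close> is the largest solution with values in \<open>[0, 1]\<close> of
  \<open>- ln (1 - v t) = \<integral> v (t - s) \<mu>(ds)\<close>. The unit atom at 0 cancels the linear term on the left,
  so \<open>v\<close> satisfies, up to constants, \<open>v(t)\<^sup>2 = \<integral> v (t - s) d\<mu>\<^sub>+(s)\<close>. Following \<open>v\<close> along levels
  that decay doubly exponentially, a nonzero solution exists if and only if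
  \<open>\<Sum>\<^sub>k \<mu>\<^sub>+\<^sup>-\<^sup>1 (exp (- L c\<^sup>k))\<close> converges for suitable \<open>L > 0\<close> and \<open>c > 1\<close>, and this sum is
  comparable to the integral because \<open>ln \<bar>ln x\<bar>\<close> is a primitive of \<open>- 1 / (x \<bar>ln x\<bar>)\<close> on \<open>(0, 1)\<close>.
\<close>

section \<open>Points of a locally finite point measure\<close>

text \<open>The quadratic balance decides how fast the levels decay. If \<open>v\<close> drops from
  a level a to a level b when time goes back by d, then a^2 / 2 is at most a F(d) + b F(t). With b a
  small multiple of a^2 this forces F(d) to be at least of order a, so levels get squared.
  Conversely, b F(d) \<ge> 2 a^2 suffices for a subsolution; when F(d) is bounded below by a fixed
  power of b, this leaves room only for exponents growing by a factor below 2. The two implications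
  therefore use different scales, c = 2 and c = 3/2, and different L. This is harmless: in the
  variable ln (- ln x) either scale is an arithmetic progression, so either series controls the
  integral near 0. The analysis concerns \<mu> alone. There \<open>v\<close> is the decreasing limit
  of iterates, so that the lower bound becomes an induction over the iterates and the upper bound
  uses only the equation. Probability enters through the first generation and the independence of
  the subtrees.\<close>

lemma sets_point_measure [simp]: "m \<in> point_measures \<Longrightarrow> sets m = sets half_line"
  by (auto simp: point_measures_def)

lemma Icc_half_line [simp]: "0 \<le> a \<Longrightarrow> {a..b} \<in> sets half_line" for a b :: real
  by (auto simp: sets_restrict_space_iff)

lemma point_measure_integer_valued:
  assumes "m \<in> point_measures" "A \<in> sets half_line"
  shows "emeasure m A = \<infinity> \<or> (\<exists>k. emeasure m A = of_nat k)"
proof -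
  from assms(1) obtain J :: "nat set" and x where m: "m = distr (count_space J) half_line x" and x: "x \<in> J \<rightarrow> {0..}"
    by (auto simp: point_measures_def)
  have "x \<in> measurable (count_space J) half_line"
    using x by (simp add: measurable_restrict_space2_iff)
  then have "emeasure m A = emeasure (count_space J) (x -` A \<inter> J)"
    using assms(2) by (simp add: m emeasure_distr)
  then show ?thesis
    by (cases "finite (x -` A \<inter> J)") (auto simp: emeasure_count_space)
qed

text \<open>The infimum in \<open>point_time\<close> is attained because the count on [0, s] is
  right-continuous in s: this is continuity from above along [0, s + 1/n], where finiteness is
  essential.\<close>

lemma point_time_le_iff:
  assumes m: "m \<in> point_measures" and fin: "\<And>s. 0 \<le> s \<Longrightarrow> emeasure m {0..s} < \<infinity>" and s: "0 \<le> s"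
  shows "point_time m j \<le> ennreal s \<longleftrightarrow> of_nat j \<le> emeasure m {0..s}"
proof
  assume le: "point_time m j \<le> ennreal s"
  have ge: "of_nat j \<le> emeasure m {0..s + 1 / Suc n}" for n
  proof -
    have "ennreal s < ennreal (s + 1 / Suc n)"
      using s by (subst ennreal_less_iff) auto
    with le have "point_time m j < ennreal (s + 1 / Suc n)" by order
    then obtain r where r: "0 \<le> r" "of_nat j \<le> emeasure m {0..r}" "ennreal r < ennreal (s + 1 / Suc n)"
      unfolding point_time_def Inf_less_iff by auto
    then have "r \<le> s + 1 / Suc n" by (simp add: ennreal_less_iff)
    then have "emeasure m {0..r} \<le> emeasure m {0..s + 1 / Suc n}"
      using m s by (intro emeasure_mono) auto
    with r show ?thesis by order
  qed
  have lim: "(\<lambda>n. s + 1 / Suc n) \<longlonglongrightarrow> s"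
    using tendsto_add[OF tendsto_const[of s] LIMSEQ_inverse_real_of_nat] by (simp add: inverse_eq_divide)
  have "(INF n. emeasure m {0..s + 1 / Suc n}) = emeasure m (\<Inter>n. {0..s + 1 / Suc n})"
  proof (rule INF_emeasure_decseq)
    show "range (\<lambda>n. {0..s + 1 / Suc n}) \<subseteq> sets m" using m by auto
    show "decseq (\<lambda>n. {0..s + 1 / Suc n})"
      unfolding decseq_def
    proof (intro allI impI)
      fix k n :: nat assume "k \<le> n"
      then have "1 / real (Suc n) \<le> 1 / real (Suc k)" by (intro frac_le) auto
      then show "{0..s + 1 / Suc n} \<subseteq> {0..s + 1 / Suc k}" by auto
    qed
    show "emeasure m {0..s + 1 / Suc n} \<noteq> \<infinity>" for n
      using fin[of "s + 1 / Suc n"] s by auto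
  qed
  moreover have "(\<Inter>n. {0..s + 1 / Suc n}) = {0..s}"
  proof (intro set_eqI iffI)
    fix x assume x: "x \<in> (\<Inter>n. {0..s + 1 / Suc n})"
    have "x \<le> s" by (rule LIMSEQ_le_const[OF lim]) (use x in auto)
    with x show "x \<in> {0..s}" by auto
  qed (auto intro: order.trans)
  ultimately show "of_nat j \<le> emeasure m {0..s}"
    using ge by (metis INF_greatest)
qed (use s in \<open>auto simp: point_time_def intro!: Inf_lower\<close>)

text \<open>Membership in \<open>point_measures\<close> gives points in an arbitrary enumeration.
  Here the measure on [0, t] is rebuilt from its ordered points, since a finite Borel measure is
  determined by its distribution function.\<close>

lemma emeasure_point_times:
  assumes m: "m \<in> point_measures" and fin: "\<And>s. 0 \<le> s \<Longrightarrow> emeasure m {0..s} < \<infinity>" and t: "0 \<le> t"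
    and B: "B \<in> sets half_line" "B \<subseteq> {0..t}"
  defines "J \<equiv> {j. 1 \<le> j \<and> point_time m j \<le> ennreal t}"
  shows "finite J" "emeasure m B = of_nat (card {j \<in> J. enn2real (point_time m j) \<in> B})"
proof -
  define X where "X j = enn2real (point_time m j)" for j
  have "\<exists>N. emeasure m {0..s} = of_nat N" if "0 \<le> s" for s
    using point_measure_integer_valued[OF m, of "{0..s}"] fin[OF that] by auto
  then obtain N where N: "\<And>s. 0 \<le> s \<Longrightarrow> emeasure m {0..s} = of_nat (N s)"
    by metis
  have pt: "point_time m j \<le> ennreal s \<longleftrightarrow> j \<le> N s" if "0 \<le> s" for s j
    using point_time_le_iff[OF m fin that] N[OF that] by simp
  \<comment> \<open>Point times increase with the index, so the points up to time t have an initial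
    segment of indices. This is what makes the two distribution functions agree.\<close>
  have J: "J = {1..N t}" by (simp add: J_def set_eq_iff pt[OF t])
  then show "finite J" by simp
  have X: "X j \<le> s \<longleftrightarrow> j \<le> N s" if "j \<in> J" "0 \<le> s" for j s
  proof -
    have "point_time m j < top" using that by (auto simp: J_def intro: le_less_trans)
    then have "point_time m j = ennreal (X j)" by (simp add: X_def)
    then show ?thesis using pt[OF that(2), of j] that(2) by (metis ennreal_le_iff)
  qed
  define M1 where "M1 = distr (restrict_space m {0..t}) borel (\<lambda>x. x)"
  define M2 where "M2 = distr (count_space J) borel X"
  have r1: "(\<lambda>x. x) \<in> measurable (restrict_space m {0..t}) borel"
    by (intro measurable_restrict_space1) (simp add: measurable_cong_sets[OF sets_point_measure[OF m] refl] measurable_restrict_space1)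
  have e1: "emeasure M1 A = emeasure m (A \<inter> {0..t})" if "A \<in> sets borel" for A
  proof -
    have "space m = {0..}" using sets_eq_imp_space_eq[OF sets_point_measure[OF m]] by simp
    then have "emeasure M1 A = emeasure (restrict_space m {0..t}) (A \<inter> {0..t})"
      using that r1 by (auto simp: M1_def emeasure_distr space_restrict_space intro!: arg_cong2[where f=emeasure])
    also have "\<dots> = emeasure m (A \<inter> {0..t})"
      using m by (intro emeasure_restrict_space) auto
    finally show ?thesis .
  qed
  have e2: "emeasure M2 A = of_nat (card {j \<in> J. X j \<in> A})" if "A \<in> sets borel" for A
  proof -
    have "emeasure M2 A = emeasure (count_space J) (X -` A \<inter> J)"
      using that by (simp add: M2_def emeasure_distr)
    also have "X -` A \<inter> J = {j \<in> J. X j \<in> A}" by auto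
    finally show ?thesis using \<open>finite J\<close> by (simp add: emeasure_count_space)
  qed
  have "M1 = M2"
  proof (rule cdf_unique')
    have "space M1 = UNIV" "space M2 = UNIV" "sets M1 = sets borel" "sets M2 = sets borel"
      by (simp_all add: M1_def M2_def)
    moreover have "emeasure M1 UNIV \<noteq> \<infinity>" "emeasure M2 UNIV \<noteq> \<infinity>"
      using fin[OF t] by (simp_all add: e1 e2)
    ultimately show "finite_borel_measure M1" "finite_borel_measure M2"
      by (simp_all add: finite_borel_measure_def finite_borel_measure_axioms_def finite_measureI)
    show "cdf M1 = cdf M2"
    proof
      fix s
      have "emeasure M1 {..s} = emeasure M2 {..s}"
      proof (cases "s < 0")
        case True
        then have "{..s} \<inter> {0..t} = {}" by auto
        moreover have "{j \<in> J. X j \<in> {..s}} = {}"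
          using True by (auto simp: X_def not_le intro: less_le_trans)
        ultimately show ?thesis
          by (simp only: e1 e2 sets.empty_sets borel_closed closed_atMost) simp
      next
        case False
        then have "{..s} \<inter> {0..t} = {0..min s t}" by auto
        then have "emeasure M1 {..s} = of_nat (N (min s t))" using False t by (simp add: e1 N)
        moreover have "{j \<in> J. X j \<in> {..s}} = {1..N (min s t)}"
        proof -
          have "N (min s t) \<le> N t"
            using pt[OF t, of "N (min s t)"] pt[of "min s t" "N (min s t)"] False t
            by (metis dual_order.trans ennreal_leI linorder_not_le min.bounded_iff min.cobounded2 order_refl)
          moreover have "X j \<le> s \<longleftrightarrow> j \<le> N (min s t)" if "j \<in> J" for j
          proof -
            have "X j \<le> t" using that X[OF that t] by (simp add: J)
            then have "X j \<le> s \<longleftrightarrow> X j \<le> min s t" by simp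
            also have "\<dots> \<longleftrightarrow> j \<le> N (min s t)"
              using X[OF that, of "min s t"] False t by simp
            finally show ?thesis .
          qed
          ultimately show ?thesis by (auto simp: J)
        qed
        ultimately show ?thesis by (simp add: e2)
      qed
      then show "cdf M1 s = cdf M2 s" by (simp add: cdf_def measure_def)
    qed
  qed
  moreover have B': "B \<in> sets borel" using B by (simp add: sets_restrict_space_iff)
  moreover have "B \<inter> {0..t} = B" using B by auto
  ultimately show "emeasure m B = of_nat (card {j \<in> J. enn2real (point_time m j) \<in> B})"
    using e1[OF B'] e2[OF B'] by (simp add: X_def)
qed

section \<open>Measurability of counts and point times\<close>

lemma space_point_measure_algebra [simp]: "space point_measure_algebra = point_measures"
  unfolding point_measure_algebra_def by (rule space_measure_of) auto

lemma measurable_emeasure_point_measure [measurable]: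
  "A \<in> sets half_line \<Longrightarrow> (\<lambda>m. emeasure m A) \<in> borel_measurable point_measure_algebra"
proof (rule measurableI)
  fix B :: "ennreal set" assume "A \<in> sets half_line" "B \<in> sets borel"
  moreover have "(\<lambda>m. emeasure m A) -` B \<inter> space point_measure_algebra = {m \<in> point_measures. emeasure m A \<in> B}"
    by auto
  ultimately show "(\<lambda>m. emeasure m A) -` B \<inter> space point_measure_algebra \<in> sets point_measure_algebra"
    unfolding point_measure_algebra_def
    by (subst sets_measure_of) (auto intro!: sigma_sets.Basic)
qed auto

text \<open>A strict bound leaves room to move the witness up to a rational time, which turns the
  sublevel sets of \<open>point_time\<close> into countable unions. The criterion
  \<open>point_time_le_iff\<close> covers only locally finite measures, while measurability is
  required on all of \<open>point_measures\<close>.\<close>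

lemma point_time_less_iff:
  assumes "m \<in> point_measures"
  shows "point_time m j < c \<longleftrightarrow> (\<exists>r::rat. 0 \<le> r \<and> ennreal (of_rat r) < c \<and> of_nat j \<le> emeasure m {0..of_rat r})"
proof
  assume "point_time m j < c"
  then obtain t where t: "0 \<le> t" "of_nat j \<le> emeasure m {0..t}" "ennreal t < c"
    unfolding point_time_def Inf_less_iff by auto
  obtain d where d: "ennreal t < d" "d < c" using t dense by blast
  then have "d < top" by (auto intro: less_le_trans)
  then have d': "d = ennreal (enn2real d)" by simp
  then have "t < enn2real d" using d(1) t by (metis ennreal_less_iff)
  then obtain r where r: "t < of_rat r" "of_rat r < enn2real d" using of_rat_dense by blast
  have "0 \<le> real_of_rat r" using r t by linarith
  then have "ennreal (of_rat r) < ennreal (enn2real d)" using r by (simp add: ennreal_less_iff)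
  then have "ennreal (of_rat r) < c" using d d' by simp
  moreover have "emeasure m {0..t} \<le> emeasure m {0..of_rat r}"
    using r assms by (intro emeasure_mono) auto
  moreover have "0 \<le> r" using \<open>0 \<le> real_of_rat r\<close> by simp
  ultimately show "\<exists>r::rat. 0 \<le> r \<and> ennreal (of_rat r) < c \<and> of_nat j \<le> emeasure m {0..of_rat r}"
    using t by (metis order.trans)
next
  assume "\<exists>r::rat. 0 \<le> r \<and> ennreal (of_rat r) < c \<and> of_nat j \<le> emeasure m {0..of_rat r}"
  then show "point_time m j < c" unfolding point_time_def Inf_less_iff 
    by (metis (mono_tags, lifting) mem_Collect_eq zero_le_of_rat_iff)
qed

lemma measurable_point_time [measurable]: "(\<lambda>m. point_time m j) \<in> borel_measurable point_measure_algebra"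
proof (rule borel_measurableI_less)
  fix c :: ennreal
  have "{m \<in> space point_measure_algebra. point_time m j < c} =
    {m \<in> space point_measure_algebra. \<exists>r::rat. 0 \<le> r \<and> ennreal (of_rat r) < c \<and> of_nat j \<le> emeasure m {0..of_rat r}}"
    using point_time_less_iff by auto
  also have "\<dots> = (\<Union>r\<in>{r::rat. 0 \<le> r \<and> ennreal (of_rat r) < c}. {m \<in> space point_measure_algebra. of_nat j \<le> emeasure m {0..of_rat r}})"
    by auto
  also have "\<dots> \<in> sets point_measure_algebra"
  proof (rule sets.countable_UN'')
    fix r :: rat
    have [measurable]: "{0..of_rat r::real} \<in> sets half_line" by simp
    show "{m \<in> space point_measure_algebra. of_nat j \<le> emeasure m {0..of_rat r}} \<in> sets point_measure_algebra"
      by measurable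
  qed auto
  finally show "{m \<in> space point_measure_algebra. point_time m j < c} \<in> sets point_measure_algebra" .
qed

section \<open>The generating functional of a Poisson process\<close>

text \<open>Indices start at 1, because \<open>point_time m 0\<close> is always 0 and stands for no
  point.\<close>

definition points_upto :: "real measure \<Rightarrow> real \<Rightarrow> nat set" where
  "points_upto m t = {j. 1 \<le> j \<and> point_time m j \<le> ennreal t}"

definition locally_finite :: "real measure \<Rightarrow> bool" where
  "locally_finite m \<longleftrightarrow> (\<forall>t\<ge>0. emeasure m {0..t} < \<infinity>)"

text \<open>Integer times suffice by monotonicity. Hence the exceptional null sets in
  \<open>reproduction_process\<close>, one for each time, can be merged into a single one.\<close>

lemma locally_finite_iff:
  assumes "m \<in> point_measures"
  shows "locally_finite m \<longleftrightarrow> (\<forall>n::nat. emeasure m {0..real n} < \<infinity>)"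
proof
  assume *: "\<forall>n::nat. emeasure m {0..real n} < \<infinity>"
  show "locally_finite m" unfolding locally_finite_def
  proof (intro allI impI)
    fix t :: real
    obtain n :: nat where "t \<le> real n" using real_arch_simple by blast
    then have "emeasure m {0..t} \<le> emeasure m {0..real n}"
      using assms by (intro emeasure_mono) auto
    then show "emeasure m {0..t} < \<infinity>" using * by (meson le_less_trans)
  qed
qed (auto simp: locally_finite_def)

lemma measurable_locally_finite [measurable]:
  "{m \<in> point_measures. locally_finite m} \<in> sets point_measure_algebra"
proof -
  have "{m \<in> space point_measure_algebra. \<forall>n::nat. emeasure m {0..real n} < \<infinity>} \<in> sets point_measure_algebra"
  proof (rule sets.sets_Collect_countable_All)
    fix n :: nat
    have [measurable]: "{0..real n} \<in> sets half_line" by simp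
    show "{m \<in> space point_measure_algebra. emeasure m {0..real n} < \<infinity>} \<in> sets point_measure_algebra"
      by measurable
  qed
  also have "{m \<in> space point_measure_algebra. \<forall>n::nat. emeasure m {0..real n} < \<infinity>} = {m \<in> point_measures. locally_finite m}"
    using locally_finite_iff by auto
  finally show ?thesis .
qed

lemma reproduction_process_locally_finite:
  assumes "reproduction_process M \<xi>"
  shows "AE \<omega> in M. \<xi> \<omega> \<in> point_measures \<and> locally_finite (\<xi> \<omega>)"
proof -
  have "AE \<omega> in M. \<forall>n::nat. emeasure (\<xi> \<omega>) {0..real n} < \<infinity>"
    using assms unfolding AE_all_countable by (auto simp: reproduction_process_def)
  moreover have "AE \<omega> in M. \<xi> \<omega> \<in> point_measures"
    using assms by (intro AE_I2) (auto simp: reproduction_process_def dest: measurable_space)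
  ultimately show ?thesis
    by eventually_elim (simp add: locally_finite_iff)
qed

text \<open>The power c^x for a count x in [0, \<infinity>], as a series so that it is visibly
  measurable. It is 0 at \<infinity>, and the convention 0^0 = 1 makes an empty cell contribute the
  factor 1 even for c = 0.\<close>

definition ennpow :: "real \<Rightarrow> ennreal \<Rightarrow> ennreal" where
  "ennpow c x = (\<Sum>k. ennreal (c ^ k) * indicator {of_nat k} x)"

lemma ennpow_of_nat: "ennpow c (of_nat n) = ennreal (c ^ n)"
proof -
  have "ennpow c (of_nat n) = (\<Sum>k\<in>{n}. ennreal (c ^ k) * indicator {of_nat k} (of_nat n :: ennreal))"
    unfolding ennpow_def by (rule suminf_finite) (auto simp: indicator_def)
  then show ?thesis by simp
qed

lemma measurable_ennpow [measurable]: "ennpow c \<in> borel_measurable borel"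
  unfolding ennpow_def by measurable

lemma poisson_generating_function:
  assumes "prob_space M" "poisson_distributed M X (ennreal a)" "0 \<le> a" "0 \<le> c"
  shows "(\<integral>\<^sup>+\<omega>. ennpow c (X \<omega>) \<partial>M) = ennreal (exp (- ((1 - c) * a)))"
proof -
  interpret prob_space M by fact
  have [measurable]: "X \<in> borel_measurable M"
    using assms(2) by (simp add: poisson_distributed_def)
  have p: "measure M {\<omega> \<in> space M. X \<omega> = of_nat k} = a ^ k / fact k * exp (- a)" for k
    using assms by (simp add: poisson_distributed_def)
  have "(\<integral>\<^sup>+\<omega>. ennpow c (X \<omega>) \<partial>M) = (\<Sum>k. \<integral>\<^sup>+\<omega>. ennreal (c ^ k) * indicator {of_nat k} (X \<omega>) \<partial>M)"
    unfolding ennpow_def by (rule nn_integral_suminf) measurable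
  also have "\<dots> = (\<Sum>k. ennreal ((c * a) ^ k / fact k * exp (- a)))"
  proof (rule suminf_cong)
    fix k
    have "(\<integral>\<^sup>+\<omega>. ennreal (c ^ k) * indicator {of_nat k} (X \<omega>) \<partial>M)
        = (\<integral>\<^sup>+\<omega>. ennreal (c ^ k) * indicator {\<omega> \<in> space M. X \<omega> = of_nat k} \<omega> \<partial>M)"
      by (intro nn_integral_cong) (auto simp: indicator_def)
    also have "\<dots> = ennreal (c ^ k) * emeasure M {\<omega> \<in> space M. X \<omega> = of_nat k}"
      by (rule nn_integral_cmult_indicator) measurable
    also have "\<dots> = ennreal (c ^ k * (a ^ k / fact k * exp (- a)))"
      unfolding emeasure_eq_measure p using assms(3,4) by (intro ennreal_mult[symmetric]) auto
    finally show "(\<integral>\<^sup>+\<omega>. ennreal (c ^ k) * indicator {of_nat k} (X \<omega>) \<partial>M) = ennreal ((c * a) ^ k / fact k * exp (- a))"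
      by (simp add: power_mult_distrib mult_ac)
  qed
  also have "\<dots> = ennreal (exp (c * a) * exp (- a))"
  proof (rule suminf_ennreal_eq)
    have "(\<lambda>k. (c * a) ^ k / fact k) sums exp (c * a)"
      using exp_converges[of "c * a"] by (simp add: divide_inverse mult_ac)
    then show "(\<lambda>k. (c * a) ^ k / fact k * exp (- a)) sums (exp (c * a) * exp (- a))"
      by (rule sums_mult2)
  qed (use assms in auto)
  also have "exp (c * a) * exp (- a) = exp (- ((1 - c) * a))"
    by (simp add: exp_add[symmetric] algebra_simps)
  finally show ?thesis .
qed

text \<open>An infinite mean would make the count infinite almost surely, by the convention in
  \<open>poisson_distributed\<close>, against local finiteness.\<close>

lemma poisson_intensity_locally_finite:
  assumes "prob_space M" "reproduction_process M \<xi>" "poisson_point_process M \<xi> \<mu>" "0 \<le> t"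
  shows "emeasure \<mu> {0..t} < \<infinity>"
proof (rule ccontr)
  interpret prob_space M by fact
  assume "\<not> emeasure \<mu> {0..t} < \<infinity>"
  then have "emeasure \<mu> {0..t} = \<infinity>" by (simp add: less_top[symmetric])
  moreover have "poisson_distributed M (\<lambda>\<omega>. emeasure (\<xi> \<omega>) {0..t}) (emeasure \<mu> {0..t})"
    using assms by (auto simp: poisson_point_process_def)
  ultimately have "AE \<omega> in M. emeasure (\<xi> \<omega>) {0..t} = \<infinity>"
    by (simp add: poisson_distributed_def)
  moreover have "AE \<omega> in M. emeasure (\<xi> \<omega>) {0..t} < \<infinity>"
    using assms by (auto simp: reproduction_process_def)
  ultimately have "AE \<omega> in M. False" by eventually_elim auto
  then show False by simp
qed

lemma finite_points_upto:
  assumes "m \<in> point_measures" "locally_finite m" "0 \<le> t"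
  shows "finite (points_upto m t)"
  using emeasure_point_times(1)[OF assms(1) _ assms(3), of "{0..t}"] assms
  by (simp add: locally_finite_def points_upto_def)

text \<open>Grouping the points by cells, a cell contributes one factor \<open>c i\<close> for each
  of its points, and their number is the mass of the cell.\<close>

lemma prod_points_step:
  fixes n :: nat
  assumes m: "m \<in> point_measures" "locally_finite m" and t: "0 \<le> t"
    and B: "\<And>i. i < n \<Longrightarrow> B i \<in> sets half_line" "\<And>i. i < n \<Longrightarrow> B i \<subseteq> {0..t}"
    and disj: "disjoint_family_on B {..<n}" and cover: "{0..t} \<subseteq> (\<Union>i<n. B i)"
    and g: "\<And>i s. i < n \<Longrightarrow> s \<in> B i \<Longrightarrow> g s = c i" and c: "\<And>i. i < n \<Longrightarrow> 0 \<le> c i"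
  shows "(\<Prod>i<n. ennpow (c i) (emeasure m (B i))) = ennreal (\<Prod>j\<in>points_upto m t. g (enn2real (point_time m j)))"
proof -
  define X where "X j = enn2real (point_time m j)" for j
  define J where "J i = {j \<in> points_upto m t. X j \<in> B i}" for i
  have fin: "finite (points_upto m t)" using finite_points_upto m t by blast
  have e: "emeasure m (B i) = of_nat (card (J i))" if "i < n" for i
    using emeasure_point_times(2)[OF m(1) _ t B(1)[OF that] B(2)[OF that]] m(2)
    by (simp add: locally_finite_def J_def points_upto_def X_def)
  have "X j \<in> {0..t}" if "j \<in> points_upto m t" for j
    using that t by (auto simp: points_upto_def X_def intro!: enn2real_leI)
  then have U: "points_upto m t = (\<Union>i<n. J i)" using cover by (fastforce simp: J_def)
  have "(\<Prod>j\<in>points_upto m t. g (X j)) = (\<Prod>i<n. \<Prod>j\<in>J i. g (X j))"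
    unfolding U
  proof (rule prod.UNION_disjoint)
    show "\<forall>i\<in>{..<n}. finite (J i)" using fin by (auto simp: J_def)
    show "\<forall>i\<in>{..<n}. \<forall>j\<in>{..<n}. i \<noteq> j \<longrightarrow> J i \<inter> J j = {}"
      using disj by (auto simp: J_def disjoint_family_on_def)
  qed simp
  also have "\<dots> = (\<Prod>i<n. c i ^ card (J i))"
    using g by (intro prod.cong refl) (simp add: J_def)
  finally have "ennreal (\<Prod>j\<in>points_upto m t. g (X j)) = (\<Prod>i<n. ennreal (c i ^ card (J i)))"
    using c by (subst prod_ennreal) auto
  then show ?thesis
    by (simp add: e ennpow_of_nat X_def)
qed

text \<open>Counts in disjoint cells are independent, so the expectation factors into
  one-dimensional Poisson generating functions.\<close>

lemma poisson_generating_functional_step: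
  fixes n :: nat
  assumes M: "prob_space M" "reproduction_process M \<xi>" "poisson_point_process M \<xi> \<mu>" and t: "0 \<le> t"
    and B: "\<And>i. i < n \<Longrightarrow> B i \<in> sets half_line" "\<And>i. i < n \<Longrightarrow> B i \<subseteq> {0..t}"
    and disj: "disjoint_family_on B {..<n}" and c: "\<And>i. i < n \<Longrightarrow> 0 \<le> c i"
  shows "(\<integral>\<^sup>+\<omega>. (\<Prod>i<n. ennpow (c i) (emeasure (\<xi> \<omega>) (B i))) \<partial>M)
    = ennreal (exp (- (\<Sum>i<n. (1 - c i) * measure \<mu> (B i))))"
proof -
  interpret prob_space M by fact
  have sets: "sets \<mu> = sets half_line" using M by (simp add: poisson_point_process_def)
  have fin: "emeasure \<mu> (B i) = ennreal (measure \<mu> (B i))" if "i < n" for i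
  proof (rule emeasure_eq_ennreal_measure)
    have "emeasure \<mu> (B i) \<le> emeasure \<mu> {0..t}"
      using B[OF that] sets by (intro emeasure_mono) auto
    also have "\<dots> < \<infinity>" using poisson_intensity_locally_finite[OF M t] .
    finally show "emeasure \<mu> (B i) \<noteq> top" by simp
  qed
  have "indep_vars (\<lambda>_. borel) (\<lambda>i \<omega>. emeasure (\<xi> \<omega>) (B i)) {..<n}"
    using M(3) B(1) disj by (simp add: poisson_point_process_def)
  then have ind: "indep_vars (\<lambda>_. borel) (\<lambda>i \<omega>. ennpow (c i) (emeasure (\<xi> \<omega>) (B i))) {..<n}"
    by (rule indep_vars_compose2) measurable
  have "(\<integral>\<^sup>+\<omega>. (\<Prod>i<n. ennpow (c i) (emeasure (\<xi> \<omega>) (B i))) \<partial>M)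
     = (\<Prod>i<n. \<integral>\<^sup>+\<omega>. ennpow (c i) (emeasure (\<xi> \<omega>) (B i)) \<partial>M)"
    by (rule indep_vars_nn_integral[OF _ ind]) auto
  also have "\<dots> = (\<Prod>i<n. ennreal (exp (- ((1 - c i) * measure \<mu> (B i)))))"
  proof (rule prod.cong[OF refl])
    fix i assume "i \<in> {..<n}"
    then have i: "i < n" by simp
    have "poisson_distributed M (\<lambda>\<omega>. emeasure (\<xi> \<omega>) (B i)) (ennreal (measure \<mu> (B i)))"
      using M(3) B(1)[OF i] fin[OF i] by (auto simp: poisson_point_process_def)
    from poisson_generating_function[OF M(1) this _ c[OF i]]
    show "(\<integral>\<^sup>+\<omega>. ennpow (c i) (emeasure (\<xi> \<omega>) (B i)) \<partial>M) = ennreal (exp (- ((1 - c i) * measure \<mu> (B i))))"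
      by simp
  qed
  also have "\<dots> = ennreal (exp (- (\<Sum>i<n. (1 - c i) * measure \<mu> (B i))))"
    by (simp add: prod_ennreal exp_sum[symmetric] sum_negf)
  finally show ?thesis .
qed

text \<open>The function h is approximated from below by step functions. Almost surely only finitely
  many points lie in [0, t], so the products converge; dominated convergence then applies to the
  expectation and to the integral in the exponent.\<close>

theorem poisson_generating_functional:
  assumes M: "prob_space M" "reproduction_process M \<xi>" "poisson_point_process M \<xi> \<mu>" and t: "0 \<le> t"
    and h [measurable]: "h \<in> borel_measurable half_line" and h01: "\<And>s. 0 \<le> h s" "\<And>s. h s \<le> 1"
  shows "(\<integral>\<^sup>+\<omega>. ennreal (\<Prod>j\<in>points_upto (\<xi> \<omega>) t. h (enn2real (point_time (\<xi> \<omega>) j))) \<partial>M)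
    = ennreal (exp (- (LINT s:{0..t}|\<mu>. 1 - h s)))"
proof -
  interpret prob_space M by fact
  have \<xi> [measurable]: "\<xi> \<in> measurable M point_measure_algebra"
    using M by (simp add: reproduction_process_def)
  have sets [measurable_cong]: "sets \<mu> = sets half_line"
    using M by (simp add: poisson_point_process_def)
  have space: "space \<mu> = {0..}" using sets_eq_imp_space_eq[OF sets] by simp
  have fin: "emeasure \<mu> {0..t} < \<infinity>" using poisson_intensity_locally_finite[OF M t] .
  define c where "c K i = real i / real (Suc K)" for K i
  \<comment> \<open>For h with values in [0, 1] the floor ranges over 0, ..., K + 1, the last value
    occurring only where h is 1. This is why there are K + 2 cells.\<close>
  define B where "B K i = {s \<in> {0..t}. \<lfloor>real (Suc K) * h s\<rfloor> = int i}" for K i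
  define g where "g K s = of_int \<lfloor>real (Suc K) * h s\<rfloor> / real (Suc K)" for K s
  have B_sets: "B K i \<in> sets half_line" for K i
  proof -
    have "{s \<in> space half_line. \<lfloor>real (Suc K) * h s\<rfloor> = int i} \<inter> {0..t} \<in> sets half_line"
      by (intro sets.Int) (measurable, simp)
    also have "{s \<in> space half_line. \<lfloor>real (Suc K) * h s\<rfloor> = int i} \<inter> {0..t} = B K i"
      by (auto simp: B_def)
    finally show ?thesis .
  qed
  have B_sub: "B K i \<subseteq> {0..t}" for K i by (auto simp: B_def)
  have B_disj: "disjoint_family_on (B K) {..<K + 2}" for K
    by (auto simp: disjoint_family_on_def B_def)
  have B_cover: "{0..t} \<subseteq> (\<Union>i<K + 2. B K i)" for K
  proof
    fix s assume "s \<in> {0..t}"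
    moreover have "0 \<le> \<lfloor>real (Suc K) * h s\<rfloor>" using h01[of s] by simp
    moreover have "real (Suc K) * h s \<le> real (Suc K)"
      using h01[of s] by (intro mult_left_le) auto
    then have "\<lfloor>real (Suc K) * h s\<rfloor> \<le> int (Suc K)" by linarith
    ultimately show "s \<in> (\<Union>i<K + 2. B K i)"
      by (auto simp: B_def intro!: bexI[of _ "nat \<lfloor>real (Suc K) * h s\<rfloor>"])
  qed
  have g_B: "g K s = c K i" if "s \<in> B K i" for K i s using that by (simp add: g_def c_def B_def)
  have g01: "0 \<le> g K s" "g K s \<le> h s" for K s
    using h01[of s] by (auto simp: g_def field_simps)
  have g_lim: "(\<lambda>K. g K s) \<longlonglongrightarrow> h s" for s
  proof (rule real_tendsto_sandwich)
    have "h s - 1 / real (Suc K) \<le> g K s" for K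
    proof -
      have "real (Suc K) * h s - 1 \<le> of_int \<lfloor>real (Suc K) * h s\<rfloor>" by linarith
      then have "(real (Suc K) * h s - 1) / real (Suc K) \<le> g K s"
        unfolding g_def by (intro divide_right_mono) auto
      then show ?thesis by (simp add: diff_divide_distrib)
    qed
    then show "\<forall>\<^sub>F K in sequentially. h s - 1 / real (Suc K) \<le> g K s" by simp
    show "(\<lambda>K. h s - 1 / real (Suc K)) \<longlonglongrightarrow> h s"
      using tendsto_diff[OF tendsto_const[of "h s"] LIMSEQ_inverse_real_of_nat] by (simp add: inverse_eq_divide)
  qed (use g01 in auto)
  define u where "u K \<omega> = (\<Prod>i<K + 2. ennpow (c K i) (emeasure (\<xi> \<omega>) (B K i)))" for K \<omega>
  define w where "w \<omega> = ennreal (\<Prod>j\<in>points_upto (\<xi> \<omega>) t. h (enn2real (point_time (\<xi> \<omega>) j)))" for \<omega>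
  have u_meas [measurable]: "u K \<in> borel_measurable M" for K
  proof -
    have "(\<lambda>\<omega>. emeasure (\<xi> \<omega>) (B K i)) \<in> borel_measurable M" for i
      by (rule measurable_compose[OF \<xi> measurable_emeasure_point_measure[OF B_sets]])
    then show ?thesis unfolding u_def by measurable
  qed
  have u_eq: "AE \<omega> in M. \<forall>K. u K \<omega> = ennreal (\<Prod>j\<in>points_upto (\<xi> \<omega>) t. g K (enn2real (point_time (\<xi> \<omega>) j)))"
    using reproduction_process_locally_finite[OF M(2)]
  proof eventually_elim
    case (elim \<omega>)
    then show ?case unfolding u_def
      by (intro allI prod_points_step[OF _ _ t B_sets B_sub B_disj B_cover g_B]) (auto simp: c_def)
  qed
  have lim: "AE \<omega> in M. (\<lambda>K. u K \<omega>) \<longlonglongrightarrow> w \<omega>"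
    using u_eq
  proof eventually_elim
    case (elim \<omega>)
    show ?case unfolding elim[rule_format] w_def
      by (intro tendsto_intros g_lim)
  qed
  \<comment> \<open>The limit \<open>w\<close> is not shown to be measurable, so the dominated
    convergence theorem is applied to the lower limit of \<open>u K\<close>, which is measurable and
    agrees with \<open>w\<close> almost everywhere.\<close>
  have lims: "AE \<omega> in M. (\<lambda>K. u K \<omega>) \<longlonglongrightarrow> liminf (\<lambda>K. u K \<omega>)" "AE \<omega> in M. w \<omega> = liminf (\<lambda>K. u K \<omega>)"
    using lim by (eventually_elim, metis lim_imp_Liminf trivial_limit_sequentially)+
  have "(\<lambda>K. \<integral>\<^sup>+\<omega>. u K \<omega> \<partial>M) \<longlonglongrightarrow> (\<integral>\<^sup>+\<omega>. liminf (\<lambda>K. u K \<omega>) \<partial>M)"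
  proof (rule nn_integral_dominated_convergence[where w="\<lambda>_. 1"])
    fix K
    show "AE \<omega> in M. u K \<omega> \<le> 1"
      using u_eq
    proof eventually_elim
      case (elim \<omega>)
      have "(\<Prod>j\<in>points_upto (\<xi> \<omega>) t. g K (enn2real (point_time (\<xi> \<omega>) j))) \<le> 1"
        using g01 h01 by (intro prod_le_1) (meson order.trans)
      then show ?case unfolding elim[rule_format] by (simp add: ennreal_le_1)
    qed
  qed (use lims emeasure_space_1 in auto)
  also have "(\<integral>\<^sup>+\<omega>. liminf (\<lambda>K. u K \<omega>) \<partial>M) = (\<integral>\<^sup>+\<omega>. w \<omega> \<partial>M)"
    using lims(2) by (intro nn_integral_cong_AE) (auto elim: eventually_mono)
  finally have L1: "(\<lambda>K. \<integral>\<^sup>+\<omega>. u K \<omega> \<partial>M) \<longlonglongrightarrow> (\<integral>\<^sup>+\<omega>. w \<omega> \<partial>M)" .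
  have g_meas [measurable]: "g K \<in> borel_measurable half_line" for K
    unfolding g_def by measurable
  have intg: "(\<Sum>i<K + 2. (1 - c K i) * measure \<mu> (B K i)) = (LINT s:{0..t}|\<mu>. 1 - g K s)" for K
  proof -
    have fB: "emeasure \<mu> (B K i) < \<infinity>" for i
    proof -
      have "emeasure \<mu> (B K i) \<le> emeasure \<mu> {0..t}"
        using B_sub sets by (intro emeasure_mono) auto
      then show ?thesis using fin by (rule le_less_trans)
    qed
    have "(LINT s:{0..t}|\<mu>. 1 - g K s) = (LINT s|\<mu>. (\<Sum>i<K + 2. (1 - c K i) * indicator (B K i) s))"
      unfolding set_lebesgue_integral_def
    proof (rule Bochner_Integration.integral_cong[OF refl])
      fix s
      show "indicator {0..t} s *\<^sub>R (1 - g K s) = (\<Sum>i<K + 2. (1 - c K i) * indicator (B K i) s)"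
      proof (cases "s \<in> {0..t}")
        case True
        then obtain i where i: "i < K + 2" "s \<in> B K i" using B_cover[of K] by auto
        have "(\<Sum>k<K + 2. (1 - c K k) * indicator (B K k) s) = (\<Sum>k<K + 2. if k = i then 1 - c K i else 0)"
          using i by (intro sum.cong refl) (auto simp: B_def indicator_def)
        then show ?thesis using i True g_B[OF i(2)] by simp
      next
        case False
        then have "indicator (B K i) s = (0 :: real)" for i
          using B_sub[of K i] by (auto simp: indicator_def)
        moreover have "indicator {0..t} s = (0 :: real)" using False by (rule indicator_simps(2))
        ultimately show ?thesis by (simp only: scaleR_zero_left mult_zero_right sum.neutral_const)
      qed
    qed
    also have "\<dots> = (\<Sum>i<K + 2. (1 - c K i) * measure \<mu> (B K i))"
      using fB B_sets by (subst Bochner_Integration.integral_sum) (auto simp: sets)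
    finally show ?thesis by simp
  qed
  have Iu: "(\<integral>\<^sup>+\<omega>. u K \<omega> \<partial>M) = ennreal (exp (- (LINT s:{0..t}|\<mu>. 1 - g K s)))" for K
    unfolding u_def intg[symmetric]
    by (rule poisson_generating_functional_step[OF M t B_sets B_sub B_disj]) (simp add: c_def)
  have "(\<lambda>K. LINT s:{0..t}|\<mu>. 1 - g K s) \<longlonglongrightarrow> (LINT s:{0..t}|\<mu>. 1 - h s)"
    unfolding set_lebesgue_integral_def
  proof (rule integral_dominated_convergence[where w="indicator {0..t}"])
    show "integrable \<mu> (indicator {0..t} :: real \<Rightarrow> real)"
      using fin by (simp add: sets)
    show "AE s in \<mu>. norm (indicator {0..t} s *\<^sub>R (1 - g K s)) \<le> indicator {0..t} s" for K
    proof (intro AE_I2)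
      fix s
      have "\<bar>1 - g K s\<bar> \<le> 1" using g01[of K s] h01[of s] by linarith
      then show "norm (indicator {0..t} s *\<^sub>R (1 - g K s)) \<le> indicator {0..t} s"
        by (simp add: indicator_def)
    qed
    show "AE s in \<mu>. (\<lambda>K. indicator {0..t} s *\<^sub>R (1 - g K s)) \<longlonglongrightarrow> indicator {0..t} s *\<^sub>R (1 - h s)"
      by (intro AE_I2 tendsto_intros g_lim)
    have m: "(\<lambda>s. indicator {0..t} s *\<^sub>R (1 - f s)) \<in> borel_measurable \<mu>"
      if [measurable]: "f \<in> borel_measurable half_line" for f :: "real \<Rightarrow> real"
    proof (intro borel_measurable_scaleR borel_measurable_indicator)
      show "{0..t} \<in> sets \<mu>" by (simp add: sets)
      show "(\<lambda>s. 1 - f s) \<in> borel_measurable \<mu>"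
        unfolding measurable_cong_sets[OF sets refl] by measurable
    qed
    show "(\<lambda>s. indicator {0..t} s *\<^sub>R (1 - h s)) \<in> borel_measurable \<mu>"
      "(\<lambda>s. indicator {0..t} s *\<^sub>R (1 - g K s)) \<in> borel_measurable \<mu>" for K
      by (intro m h g_meas)+
  qed
  then have "(\<lambda>K. \<integral>\<^sup>+\<omega>. u K \<omega> \<partial>M) \<longlonglongrightarrow> ennreal (exp (- (LINT s:{0..t}|\<mu>. 1 - h s)))"
    unfolding Iu by (intro tendsto_intros)
  with L1 show ?thesis unfolding w_def by (rule LIMSEQ_unique)
qed

section \<open>The fixed point equation of the explosion probability\<close>

text \<open>The value 0 at negative times confines the integral over the half line to \<open>[0, t]\<close>.\<close>

primrec generation_prob :: "real measure \<Rightarrow> nat \<Rightarrow> real \<Rightarrow> real" where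
  "generation_prob \<mu> 0 t = (if t < 0 then 0 else 1)"
| "generation_prob \<mu> (Suc n) t = 1 - exp (- (LINT s|\<mu>. generation_prob \<mu> n (t - s)))"

text \<open>The class preserved by the fixed point map. Monotonicity gives both Borel measurability
  and the bound of f(t - s) by f(t); the other conditions bound f(t - s) by the indicator of [0, t],
  which is integrable.\<close>

definition admissible :: "(real \<Rightarrow> real) \<Rightarrow> bool" where
  "admissible f \<longleftrightarrow> mono f \<and> (\<forall>t. 0 \<le> f t \<and> f t \<le> 1) \<and> (\<forall>t<0. f t = 0)"

lemma admissible_borel_measurable : "admissible f \<Longrightarrow> f \<in> borel_measurable borel"
  by (simp add: admissible_def borel_measurable_mono)

locale critical_intensity =
  fixes \<mu> :: "real measure"
  assumes sets_mu [measurable_cong]: "sets \<mu> = sets half_line"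
    and finite_mu: "\<And>t. 0 \<le> t \<Longrightarrow> emeasure \<mu> {0..t} < \<infinity>"
    and atom: "emeasure \<mu> {0} = 1"
begin

lemma space_mu: "space \<mu> = {0..}"
  using sets_eq_imp_space_eq[OF sets_mu] by simp

lemma in_sets_mu: "B \<in> sets borel \<Longrightarrow> B \<subseteq> {0..} \<Longrightarrow> B \<in> sets \<mu>"
  by (simp add: sets_mu sets_restrict_space_iff)

lemma emeasure_bounded_finite:
  assumes "B \<in> sets borel" "B \<subseteq> {0..t}"
  shows "emeasure \<mu> B < \<infinity>"
proof (cases "0 \<le> t")
  case True
  have "emeasure \<mu> B \<le> emeasure \<mu> {0..t}"
    using assms by (intro emeasure_mono in_sets_mu) auto
  then show ?thesis using finite_mu[OF True] by (rule le_less_trans)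
qed (use assms in auto)

definition F :: "real \<Rightarrow> real" where "F t = measure \<mu> {0<..t}"

lemma mu_plus_eq: "mu_plus \<mu> t = ennreal (F t)"
  using emeasure_bounded_finite[of "{0<..t}" t]
  by (simp add: mu_plus_def F_def emeasure_eq_ennreal_measure subset_eq)

lemma F_nonneg [simp]: "0 \<le> F t" by (simp add: F_def)

lemma F_mono: "s \<le> t \<Longrightarrow> F s \<le> F t"
  unfolding F_def
  by (intro measure_mono_fmeasurable fmeasurableI in_sets_mu emeasure_bounded_finite[of _ t]) auto

lemma measurable_reflected: "f \<in> borel_measurable borel \<Longrightarrow> (\<lambda>s. f (t - s)) \<in> borel_measurable \<mu>"
  for f :: "real \<Rightarrow> real"
  unfolding measurable_cong_sets[OF sets_mu refl]
  by (rule measurable_compose[of "\<lambda>s. t - s"]) (auto intro: measurable_restrict_space1)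

lemma integrable_indicator_bounded [simp]:
  "B \<in> sets borel \<Longrightarrow> B \<subseteq> {0..t} \<Longrightarrow> integrable \<mu> (indicator B :: real \<Rightarrow> real)"
  using emeasure_bounded_finite[of B t] by (simp add: in_sets_mu subset_eq)

lemma integrable_admissible:
  assumes "admissible f"
  shows "integrable \<mu> (\<lambda>s. f (t - s))"
proof (rule Bochner_Integration.integrable_bound)
  show "integrable \<mu> (indicator {0..t} :: real \<Rightarrow> real)"
    by (rule integrable_indicator_bounded) auto
  show "(\<lambda>s. f (t - s)) \<in> borel_measurable \<mu>"
    by (intro measurable_reflected admissible_borel_measurable assms)
  show "AE s in \<mu>. norm (f (t - s)) \<le> norm (indicator {0..t} s :: real)"
    using assms by (intro AE_I2) (auto simp: admissible_def space_mu indicator_def)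
qed

lemma admissible_generation_prob: "admissible (generation_prob \<mu> n)"
proof (induction n)
  case 0
  show ?case by (auto simp: admissible_def mono_def)
next
  case (Suc n)
  let ?f = "generation_prob \<mu> n"
  have f: "0 \<le> ?f t" "?f t \<le> 1" "s \<le> t \<Longrightarrow> ?f s \<le> ?f t" "t < 0 \<Longrightarrow> ?f t = 0" for s t
    using Suc by (auto simp: admissible_def mono_def)
  have "(LINT r|\<mu>. ?f (s - r)) \<le> (LINT r|\<mu>. ?f (t - r))" if "s \<le> t" for s t
    using that by (intro integral_mono integrable_admissible[OF Suc] f) auto
  moreover have "0 \<le> (LINT r|\<mu>. ?f (t - r))" for t
    by (intro Bochner_Integration.integral_nonneg f)
  moreover have "(LINT r|\<mu>. ?f (t - r)) = 0" if "t < 0" for t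
  proof -
    have "(LINT r|\<mu>. ?f (t - r)) = (LINT r|\<mu>. 0)"
      using that by (intro Bochner_Integration.integral_cong refl f) (auto simp: space_mu)
    then show ?thesis by simp
  qed
  ultimately show ?case by (auto simp: admissible_def mono_def)
qed

text \<open>The map taking f to 1 - exp (- \<integral> f(t - s) \<mu>(ds)) is monotone, and its
  first iterate lies below the starting function, the largest admissible one.\<close>

lemma generation_prob_Suc_le: "generation_prob \<mu> (Suc n) t \<le> generation_prob \<mu> n t"
proof (induction n arbitrary: t)
  case 0
  show ?case
    using admissible_generation_prob[of 0] admissible_generation_prob[of "Suc 0"]
    by (cases "t < 0") (auto simp: admissible_def)
next
  case (Suc n)
  have "(LINT s|\<mu>. generation_prob \<mu> (Suc n) (t - s)) \<le> (LINT s|\<mu>. generation_prob \<mu> n (t - s))"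
    by (intro integral_mono integrable_admissible admissible_generation_prob Suc)
  then show ?case by simp
qed

definition explosion_prob :: "real \<Rightarrow> real" where
  "explosion_prob t = lim (\<lambda>n. generation_prob \<mu> n t)"

lemma tendsto_explosion_prob: "(\<lambda>n. generation_prob \<mu> n t) \<longlonglongrightarrow> explosion_prob t"
proof -
  have "decseq (\<lambda>n. generation_prob \<mu> n t)"
    by (intro decseq_SucI generation_prob_Suc_le)
  moreover have "0 \<le> generation_prob \<mu> n t" for n
    using admissible_generation_prob[of n] by (simp add: admissible_def)
  ultimately obtain l where "(\<lambda>n. generation_prob \<mu> n t) \<longlonglongrightarrow> l"
    using decseq_convergent by metis
  then show ?thesis by (simp add: explosion_prob_def limI)
qed

lemma admissible_explosion_prob: "admissible explosion_prob"
  unfolding admissible_def mono_def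
proof (intro conjI allI impI)
  have g: "0 \<le> generation_prob \<mu> n t" "generation_prob \<mu> n t \<le> 1" "s \<le> t \<Longrightarrow> generation_prob \<mu> n s \<le> generation_prob \<mu> n t"
    "t < 0 \<Longrightarrow> generation_prob \<mu> n t = 0" for n s t
    using admissible_generation_prob[of n] by (auto simp: admissible_def mono_def)
  show "explosion_prob s \<le> explosion_prob t" if "s \<le> t" for s t
    using g that by (intro LIMSEQ_le[OF tendsto_explosion_prob tendsto_explosion_prob]) auto
  show "0 \<le> explosion_prob t" "explosion_prob t \<le> 1" for t
    using g by (auto intro: LIMSEQ_le_const[OF tendsto_explosion_prob] LIMSEQ_le_const2[OF tendsto_explosion_prob])
  show "explosion_prob t = 0" if "t < 0" for t
    using LIMSEQ_unique[OF tendsto_explosion_prob[of t], of 0] g(4)[OF that] by simp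
qed

lemma explosion_prob_fixed_point:
  "explosion_prob t = 1 - exp (- (LINT s|\<mu>. explosion_prob (t - s)))"
proof -
  have "(\<lambda>n. LINT s|\<mu>. generation_prob \<mu> n (t - s)) \<longlonglongrightarrow> (LINT s|\<mu>. explosion_prob (t - s))"
  proof (rule integral_dominated_convergence[where w="\<lambda>s. generation_prob \<mu> 0 (t - s)"])
    show "integrable \<mu> (\<lambda>s. generation_prob \<mu> 0 (t - s))"
      by (intro integrable_admissible admissible_generation_prob)
    show "AE s in \<mu>. norm (generation_prob \<mu> n (t - s)) \<le> generation_prob \<mu> 0 (t - s)" for n
      using admissible_generation_prob[of n] by (intro AE_I2) (auto simp: admissible_def)
    show "AE s in \<mu>. (\<lambda>n. generation_prob \<mu> n (t - s)) \<longlonglongrightarrow> explosion_prob (t - s)"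
      by (intro AE_I2 tendsto_explosion_prob)
  qed (intro measurable_reflected admissible_borel_measurable admissible_generation_prob admissible_explosion_prob)+
  then have "(\<lambda>n. generation_prob \<mu> (Suc n) t) \<longlonglongrightarrow> 1 - exp (- (LINT s|\<mu>. explosion_prob (t - s)))"
    unfolding generation_prob.simps by (intro tendsto_intros)
  moreover have "(\<lambda>n. generation_prob \<mu> (Suc n) t) \<longlonglongrightarrow> explosion_prob t"
    using tendsto_explosion_prob by (rule LIMSEQ_Suc)
  ultimately show ?thesis by (rule LIMSEQ_unique[symmetric])
qed

lemma measure_atom [simp]: "measure \<mu> {0} = 1"
  using atom by (simp add: measure_def)

text \<open>The three terms come from the atom at 0, from (0, t - b], where f is at most f(t), and
  from s > t - b, where the remaining time t - s is below b. For the last range the mass is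
  generously bounded by that of (0, t].\<close>

lemma integral_admissible_le:
  assumes f: "admissible f" and b: "\<And>r. r < b \<Longrightarrow> f r \<le> a" "b \<le> t" "0 \<le> b" and a: "0 \<le> a"
  shows "(LINT s|\<mu>. f (t - s)) \<le> f t + f t * F (t - b) + a * F t"
proof -
  have i: "integrable \<mu> (indicator {0} :: real \<Rightarrow> real)" "integrable \<mu> (indicator {0<..r} :: real \<Rightarrow> real)" for r
    by (rule integrable_indicator_bounded[where t=1], auto) (rule integrable_indicator_bounded[where t=r], auto)
  have s: "{0} \<inter> space \<mu> = {0}" "{0<..r} \<inter> space \<mu> = {0<..r}" for r
    by (auto simp: space_mu)
  have "(LINT s|\<mu>. f (t - s)) \<le>
    (LINT s|\<mu>. f t * indicator {0} s + f t * indicator {0<..t - b} s + a * indicator {0<..t} s)"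
  proof (rule integral_mono)
    show "integrable \<mu> (\<lambda>s. f (t - s))" by (rule integrable_admissible[OF f])
    show "integrable \<mu> (\<lambda>s. f t * indicator {0} s + f t * indicator {0<..t - b} s + a * indicator {0<..t} s)"
      using i by simp
    fix s assume "s \<in> space \<mu>"
    then have s: "0 \<le> s" by (simp add: space_mu)
    have "f (t - s) \<le> f t" using f s by (simp add: admissible_def mono_def)
    moreover have "0 \<le> f t" "t < s \<Longrightarrow> f (t - s) = 0"
      using f by (auto simp: admissible_def)
    moreover have "f (t - s) \<le> a" if "t - b < s" using b that by simp
    ultimately show "f (t - s) \<le> f t * indicator {0} s + f t * indicator {0<..t - b} s + a * indicator {0<..t} s"
      using s a b by (auto simp: indicator_def)
  qed
  also have "\<dots> = f t + f t * F (t - b) + a * F t"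
    using i by (simp add: F_def s)
  finally show ?thesis .
qed

text \<open>Only the atom and the points in (0, d] are kept.\<close>

lemma integral_admissible_ge:
  assumes f: "admissible f" and a: "a \<le> f t" and a': "\<And>s. 0 < s \<Longrightarrow> s \<le> d \<Longrightarrow> a' \<le> f (t - s)"
  shows "a + a' * F d \<le> (LINT s|\<mu>. f (t - s))"
proof -
  have i: "integrable \<mu> (indicator {0} :: real \<Rightarrow> real)" "integrable \<mu> (indicator {0<..r} :: real \<Rightarrow> real)" for r
    by (rule integrable_indicator_bounded[where t=1], auto) (rule integrable_indicator_bounded[where t=r], auto)
  have s: "{0} \<inter> space \<mu> = {0}" "{0<..r} \<inter> space \<mu> = {0<..r}" for r
    by (auto simp: space_mu)
  have "a + a' * F d = (LINT s|\<mu>. a * indicator {0} s + a' * indicator {0<..d} s)"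
    using i by (simp add: F_def s)
  also have "\<dots> \<le> (LINT s|\<mu>. f (t - s))"
  proof (rule integral_mono)
    show "integrable \<mu> (\<lambda>s. f (t - s))" by (rule integrable_admissible[OF f])
    show "integrable \<mu> (\<lambda>s. a * indicator {0} s + a' * indicator {0<..d} s)"
      using i by simp
    fix s assume "s \<in> space \<mu>"
    then have "0 \<le> s" by (simp add: space_mu)
    moreover have "0 \<le> f (t - s)" using f by (simp add: admissible_def)
    ultimately show "a * indicator {0} s + a' * indicator {0<..d} s \<le> f (t - s)"
      using a a'[of s] by (auto simp: indicator_def)
  qed
  finally show ?thesis .
qed

end

section \<open>The integral test on a doubly exponential scale\<close>

lemma mono_mu_plus_inv: "mono (mu_plus_inv \<mu>)"
  unfolding mono_def mu_plus_inv_def by (auto intro!: Inf_superset_mono dest: ennreal_leI order.trans)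

lemma measurable_mu_plus_inv [measurable]: "mu_plus_inv \<mu> \<in> borel_measurable borel"
proof (rule borel_measurableI_less)
  fix c
  have "is_interval {x. mu_plus_inv \<mu> x < c}"
    unfolding is_interval_1 using monoD[OF mono_mu_plus_inv] by (auto intro: le_less_trans)
  then show "{x \<in> space borel. mu_plus_inv \<mu> x < c} \<in> sets borel"
    by simp (rule real_interval_borel_measurable)
qed

text \<open>In the variable ln (- ln x) the range of integration is an interval of length
  \<open>ln c\<close>, whatever L is.\<close>

lemma nn_integral_inverse_x_ln:
  assumes "0 < L" "1 < c"
  shows "(\<integral>\<^sup>+x\<in>{exp (- (L * c))..<exp (- L)}. ennreal (1 / (x * \<bar>ln x\<bar>)) \<partial>lborel) = ennreal (ln c)"
proof -
  let ?a = "exp (- (L * c))" and ?b = "exp (- L)"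
  have ab: "?a \<le> ?b" using assms by simp
  have dom: "0 < x \<and> ln x < 0" if "?a \<le> x" "x \<le> ?b" for x
  proof -
    have "0 < x" using that(1) exp_gt_zero less_le_trans by blast
    moreover have "ln x \<le> ln ?b" using that \<open>0 < x\<close> by (intro ln_mono) auto
    ultimately show ?thesis using assms by (simp del: ln_less_zero_iff ln_le_zero_iff)
  qed
  have "(\<integral>\<^sup>+x\<in>{?a..<?b}. ennreal (1 / (x * \<bar>ln x\<bar>)) \<partial>lborel) = (\<integral>\<^sup>+x. ennreal (1 / (x * \<bar>ln x\<bar>)) * indicator {?a..?b} x \<partial>lborel)"
    by (intro nn_integral_cong_AE eventually_mono[OF AE_lborel_singleton[of ?b]]) (auto simp: indicator_def)
  also have "\<dots> = ennreal (- ln (- ln ?b) - (- ln (- ln ?a)))"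
  proof (rule nn_integral_FTC_Icc[OF _ _ _ ab])
    fix x assume "x \<in> {?a..?b}"
    then have x: "?a \<le> x" "x \<le> ?b" by auto
    show "((\<lambda>x. - ln (- ln x)) has_real_derivative 1 / (x * \<bar>ln x\<bar>)) (at x)"
      using dom[OF x] by (auto intro!: derivative_eq_intros simp: field_simps)
    show "0 \<le> 1 / (x * \<bar>ln x\<bar>)" using dom[OF x] by simp
  qed measurable
  also have "- ln (- ln ?b) - (- ln (- ln ?a)) = ln c" using assms by (simp add: ln_mult)
  finally show ?thesis .
qed

text \<open>The cells [x (k + 1), x k) partition (0, x 0) and all have the same weight
  \<open>ln c\<close>. On each cell the monotone function lies between its values at the two
  endpoints.\<close>

lemma nn_integral_log_scale_bounds:
  assumes L: "0 < L" and c: "1 < c" and \<phi>: "mono \<phi>" and [measurable]: "\<phi> \<in> borel_measurable borel"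
  defines "x \<equiv> \<lambda>k::nat. exp (- (L * c ^ k))"
  shows "(\<integral>\<^sup>+y\<in>{0<..<x 0}. \<phi> y / ennreal (y * \<bar>ln y\<bar>) \<partial>lborel) \<le> (\<Sum>k. \<phi> (x k)) * ennreal (ln c)"
    and "(\<Sum>k. \<phi> (x (Suc k))) * ennreal (ln c) \<le> (\<integral>\<^sup>+y\<in>{0<..<x 0}. \<phi> y / ennreal (y * \<bar>ln y\<bar>) \<partial>lborel)"
proof -
  have cpow: "c ^ k < c ^ Suc k" "0 < c ^ k" for k using c by auto
  have x_pos: "0 < x k" and x_less: "x (Suc k) < x k" for k
    using L cpow[of k] unfolding x_def by (simp_all del: power_Suc)
  have x_anti: "decseq x" by (intro decseq_SucI less_imp_le x_less)
  have lim: "x \<longlonglongrightarrow> 0" unfolding x_def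
  proof (rule filterlim_compose[OF exp_at_bot])
    have "filterlim (\<lambda>k. L * c ^ k) at_top sequentially"
      using c by (intro filterlim_tendsto_pos_mult_at_top[OF tendsto_const L]
          filterlim_at_infinity_imp_filterlim_at_top filterlim_realpow_sequentially_gt1) auto
    then show "filterlim (\<lambda>k. - (L * c ^ k)) at_bot sequentially"
      by (simp add: filterlim_uminus_at_bot)
  qed
  define D where "D k = {x (Suc k)..<x k}" for k
  have union: "{0<..<x 0} = (\<Union>k. D k)"
  proof (intro set_eqI iffI)
    fix y assume y: "y \<in> {0<..<x 0}"
    then have "\<forall>\<^sub>F k in sequentially. x k < y" using order_tendstoD(2)[OF lim] by auto
    then have ex: "\<exists>k. x k \<le> y"
      by (auto simp: eventually_sequentially intro: less_imp_le)
    define k where "k = (LEAST k. x k \<le> y)"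
    have k: "x k \<le> y" unfolding k_def by (rule LeastI_ex[OF ex])
    with y have "k \<noteq> 0" by (cases k) auto
    then obtain j where j: "k = Suc j" by (cases k) auto
    then have "\<not> x j \<le> y" unfolding k_def using not_less_Least by (metis lessI)
    with k j show "y \<in> (\<Union>k. D k)" by (auto simp: D_def)
  next
    fix y assume "y \<in> (\<Union>k. D k)"
    then obtain k where "x (Suc k) \<le> y" "y < x k" by (auto simp: D_def)
    with x_pos[of "Suc k"] decseqD[OF x_anti, of 0 k] show "y \<in> {0<..<x 0}" by auto
  qed
  have disj: "disjoint_family D"
    unfolding disjoint_family_on_def
  proof (intro ballI impI)
    fix i j :: nat assume "i \<noteq> j"
    then have "Suc i \<le> j \<or> Suc j \<le> i" by auto
    then have "x j \<le> x (Suc i) \<or> x i \<le> x (Suc j)" using decseqD[OF x_anti] by blast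
    then show "D i \<inter> D j = {}" by (auto simp: D_def)
  qed
  let ?w = "\<lambda>y. ennreal (1 / (y * \<bar>ln y\<bar>))"
  have w: "(\<integral>\<^sup>+y\<in>D k. ?w y \<partial>lborel) = ennreal (ln c)" for k
    using nn_integral_inverse_x_ln[of "L * c ^ k" c] L c cpow by (simp add: D_def x_def mult_ac)
  \<comment> \<open>Division in \<open>ennreal\<close> becomes multiplication by the real weight
    once the denominator is known to be positive; on the cells this follows from 0 < y < 1.\<close>
  have div: "\<phi> y / ennreal (y * \<bar>ln y\<bar>) = \<phi> y * ?w y" if "y \<in> D k" for y k
  proof -
    have "0 < y" using that x_pos[of "Suc k"] by (simp add: D_def)
    moreover have "y < 1"
    proof -
      have "y < x k" using that by (simp add: D_def)
      also have "x k < 1" using L cpow by (simp add: x_def)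
      finally show ?thesis .
    qed
    ultimately have "0 < y * \<bar>ln y\<bar>" by (simp add: mult_pos_neg)
    then show ?thesis by (simp add: divide_ennreal_def inverse_ennreal inverse_eq_divide)
  qed
  have meas: "(\<lambda>y. \<phi> y / ennreal (y * \<bar>ln y\<bar>)) \<in> borel_measurable lborel"
    by measurable
  have split: "(\<integral>\<^sup>+y\<in>{0<..<x 0}. \<phi> y / ennreal (y * \<bar>ln y\<bar>) \<partial>lborel)
    = (\<Sum>k. \<integral>\<^sup>+y\<in>D k. \<phi> y / ennreal (y * \<bar>ln y\<bar>) \<partial>lborel)"
    unfolding union by (rule nn_integral_disjoint_family[OF meas _ disj]) (simp add: D_def)
  have cmul: "(\<integral>\<^sup>+y. m * (?w y * indicator (D k) y) \<partial>lborel) = m * ennreal (ln c)" for m k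
    unfolding w[of k, symmetric] by (rule nn_integral_cmult) (simp add: D_def)
  have up: "(\<integral>\<^sup>+y\<in>D k. \<phi> y / ennreal (y * \<bar>ln y\<bar>) \<partial>lborel) \<le> \<phi> (x k) * ennreal (ln c)" for k
    unfolding cmul[of _ k, symmetric]
  proof (rule nn_integral_mono)
    fix y
    show "\<phi> y / ennreal (y * \<bar>ln y\<bar>) * indicator (D k) y \<le> \<phi> (x k) * (?w y * indicator (D k) y)"
    proof (cases "y \<in> D k")
      case True
      then have "\<phi> y \<le> \<phi> (x k)" using \<phi> by (auto simp: D_def mono_def)
      then show ?thesis using div[OF True] True by (simp add: mult_right_mono)
    qed simp
  qed
  have lo: "\<phi> (x (Suc k)) * ennreal (ln c) \<le> (\<integral>\<^sup>+y\<in>D k. \<phi> y / ennreal (y * \<bar>ln y\<bar>) \<partial>lborel)" for k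
    unfolding cmul[of _ k, symmetric]
  proof (rule nn_integral_mono)
    fix y
    show "\<phi> (x (Suc k)) * (?w y * indicator (D k) y) \<le> \<phi> y / ennreal (y * \<bar>ln y\<bar>) * indicator (D k) y"
    proof (cases "y \<in> D k")
      case True
      then have "\<phi> (x (Suc k)) \<le> \<phi> y" using \<phi> by (auto simp: D_def mono_def)
      then show ?thesis using div[OF True] True by (simp add: mult_right_mono)
    qed simp
  qed
  show "(\<integral>\<^sup>+y\<in>{0<..<x 0}. \<phi> y / ennreal (y * \<bar>ln y\<bar>) \<partial>lborel) \<le> (\<Sum>k. \<phi> (x k)) * ennreal (ln c)"
    unfolding split ennreal_suminf_multc[symmetric] by (intro suminf_le up) auto
  show "(\<Sum>k. \<phi> (x (Suc k))) * ennreal (ln c) \<le> (\<integral>\<^sup>+y\<in>{0<..<x 0}. \<phi> y / ennreal (y * \<bar>ln y\<bar>) \<partial>lborel)"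
    unfolding split ennreal_suminf_multc[symmetric] by (intro suminf_le lo) auto
qed

text \<open>Here I = - ln (1 - v), whose power series v + v^2 / 2 + v^3 / 3 + ... is cut after the
  quadratic term. The difference has derivative x^2 / (1 - x).\<close>

lemma one_minus_exp_upper:
  fixes v I :: real
  assumes "v = 1 - exp (- I)" "0 \<le> v"
  shows "v + v\<^sup>2 / 2 \<le> I"
proof -
  have "v < 1" using assms by simp
  let ?g = "\<lambda>x::real. - ln (1 - x) - x - x\<^sup>2 / 2"
  have "?g 0 \<le> ?g v"
  proof (rule DERIV_nonneg_imp_nondecreasing[OF assms(2)])
    fix x assume x: "0 \<le> x" "x \<le> v"
    have "(?g has_real_derivative (1 / (1 - x) - 1 - x)) (at x)"
      using x \<open>v < 1\<close> by (auto intro!: derivative_eq_intros simp: field_simps)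
    moreover have "1 / (1 - x) - 1 - x = x\<^sup>2 / (1 - x)"
      using x \<open>v < 1\<close> by (simp add: field_simps power2_eq_square)
    then have "0 \<le> 1 / (1 - x) - 1 - x" using x \<open>v < 1\<close> by simp
    ultimately show "\<exists>y. (?g has_real_derivative y) (at x) \<and> 0 \<le> y" by blast
  qed
  moreover have "ln (1 - v) = - I" using assms(1) by simp
  ultimately show ?thesis by simp
qed

text \<open>On [0, 1/2] the function - ln (1 - a) is at most a + 2 a^2. This is the origin of the
  factor 2 in the condition on the levels of a subsolution.\<close>

lemma one_minus_exp_lower:
  fixes a I :: real
  assumes "0 \<le> a" "a \<le> 1 / 2" "a + 2 * a\<^sup>2 \<le> I"
  shows "a \<le> 1 - exp (- I)"
proof -
  have "- a - 2 * a\<^sup>2 \<le> ln (1 - a)"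
    using assms by (intro ln_one_minus_pos_lower_bound) auto
  then have "- I \<le> ln (1 - a)" using assms(3) by linarith
  then have "exp (- I) \<le> exp (ln (1 - a))" by simp
  then show ?thesis using assms by simp
qed

section \<open>Positive solutions and convergence of the integral\<close>

context critical_intensity
begin

lemma mu_plus_inv_le: "0 \<le> s \<Longrightarrow> y \<le> F s \<Longrightarrow> mu_plus_inv \<mu> y \<le> ennreal s"
  unfolding mu_plus_inv_def mu_plus_eq by (intro Inf_lower) (auto intro: ennreal_leI)

lemma le_F_if_mu_plus_inv_less:
  assumes "mu_plus_inv \<mu> y < ennreal s"
  shows "y \<le> F s"
proof -
  from assms obtain r where r: "0 \<le> r" "ennreal y \<le> ennreal (F r)" "ennreal r < ennreal s"
    unfolding mu_plus_inv_def mu_plus_eq Inf_less_iff by auto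
  then have "y \<le> F r" by (cases "0 \<le> y") (auto simp: ennreal_le_iff intro: order.trans[OF _ F_nonneg])
  moreover have "r \<le> s" using r by (simp add: ennreal_less_iff)
  ultimately show ?thesis using F_mono order.trans by blast
qed

text \<open>
  The weights \<open>a k\<close> are chosen so that \<open>a (k + 1) * x (k + 1)\<close> dominates \<open>2 * (a k)\<^sup>2\<close>, which
  makes the step function with value \<open>a k\<close> on \<open>[\<tau> k, \<tau> (k - 1))\<close> a subsolution of the fixed
  point equation of \<open>explosion_prob\<close>.
\<close>

lemma explosion_prob_pos:
  assumes "\<epsilon> > 0" and int: "(\<integral>\<^sup>+x\<in>{0<..<\<epsilon>}. mu_plus_inv \<mu> x / ennreal (x * \<bar>ln x\<bar>) \<partial>lborel) < \<infinity>"
  shows "\<exists>t\<ge>0. explosion_prob t > 0"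
proof -
  \<comment> \<open>The bound \<open>- ln \<epsilon>\<close> places \<open>x 0\<close> below
    \<epsilon>, so the given integral controls the series. The bound 1 makes every exponent
    \<open>L * c ^ k\<close> at least 1, which later absorbs the factor 2.\<close>
  define L where "L = max 1 (- ln \<epsilon>)"
  define c where "c = (3 / 2 :: real)"
  define x where "x k = exp (- (L * c ^ k))" for k :: nat
  \<comment> \<open>With \<open>a k\<close> the A-th power of \<open>x k\<close>, the condition
    \<open>a_step\<close> compares the exponents 2 A and c (A + 1), in units of
    \<open>L * c ^ k\<close>. A suitable A exists exactly for c < 2; with c = 3/2 and A = 6 they are
    12 and 10.5, leaving 1.5 to pay for the factor 2.\<close>
  define a where "a k = exp (- (6 * L * c ^ k))" for k :: nat
  have L: "1 \<le> L" "- ln \<epsilon> \<le> L" by (auto simp: L_def)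
  have c: "1 < c" by (simp add: c_def)
  have Lc: "1 \<le> L * c ^ k" for k
  proof -
    have "1 * 1 \<le> L * c ^ k" using L c by (intro mult_mono) auto
    then show ?thesis by simp
  qed
  have "x 0 \<le> exp (ln \<epsilon>)" using L by (simp add: x_def)
  then have "x 0 \<le> \<epsilon>" using \<open>\<epsilon> > 0\<close> by simp
  have "(\<Sum>k. mu_plus_inv \<mu> (x (Suc k))) * ennreal (ln c) \<le> (\<integral>\<^sup>+y\<in>{0<..<x 0}. mu_plus_inv \<mu> y / ennreal (y * \<bar>ln y\<bar>) \<partial>lborel)"
    unfolding x_def using L c
    by (intro nn_integral_log_scale_bounds(2) mono_mu_plus_inv measurable_mu_plus_inv) auto
  also have "\<dots> \<le> (\<integral>\<^sup>+y\<in>{0<..<\<epsilon>}. mu_plus_inv \<mu> y / ennreal (y * \<bar>ln y\<bar>) \<partial>lborel)"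
    using \<open>x 0 \<le> \<epsilon>\<close> by (intro nn_integral_mono mult_left_mono) (auto simp: indicator_def)
  finally have "(\<Sum>k. mu_plus_inv \<mu> (x (Suc k))) * ennreal (ln c) < \<infinity>"
    using int by (rule le_less_trans)
  moreover have "0 < ln c" using c by simp
  ultimately have sum_fin: "(\<Sum>k. mu_plus_inv \<mu> (x (Suc k))) < \<infinity>"
    by (auto simp: ennreal_mult_less_top)
  define \<phi> where "\<phi> k = enn2real (mu_plus_inv \<mu> (x (Suc k)))" for k
  have \<phi>: "mu_plus_inv \<mu> (x (Suc k)) = ennreal (\<phi> k)" for k
  proof -
    have "mu_plus_inv \<mu> (x (Suc k)) \<noteq> top"
      using ennreal_suminf_lessD[OF sum_fin, of k] by auto
    then show ?thesis by (simp add: \<phi>_def ennreal_enn2real_if)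
  qed
  have \<phi>_nonneg: "0 \<le> \<phi> k" for k by (simp add: \<phi>_def)
  have "summable \<phi>"
    using sum_fin unfolding \<phi> by (intro summable_suminf_not_top \<phi>_nonneg) simp
  \<comment> \<open>The summand \<open>(1 / 2) ^ k\<close> makes it unnecessary that \<open>mu_plus_inv\<close> is attained.\<close>
  define \<sigma> where "\<sigma> k = \<phi> k + (1 / 2) ^ k" for k
  have sum\<sigma>: "summable \<sigma>" unfolding \<sigma>_def
    by (intro summable_add \<open>summable \<phi>\<close> summable_geometric) auto
  have \<sigma>_pos: "0 < \<sigma> k" for k
    unfolding \<sigma>_def by (intro add_nonneg_pos \<phi>_nonneg) auto
  have F\<sigma>: "x (Suc k) \<le> F (\<sigma> k)" for k
    by (rule le_F_if_mu_plus_inv_less) (simp add: \<phi> \<sigma>_def \<phi>_nonneg ennreal_less_iff)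
  \<comment> \<open>The index runs backwards in time: level \<open>a k\<close> is reached by time
    \<open>\<tau> k\<close>, and the step up from the smaller level \<open>a (Suc k)\<close> takes
    time \<open>\<sigma> k\<close>. Summability of these steps makes \<open>\<tau> 0\<close> a
    finite time.\<close>
  define \<tau> where "\<tau> k = (\<Sum>j. \<sigma> (j + k))" for k
  have \<tau>_Suc: "\<tau> k = \<sigma> k + \<tau> (Suc k)" for k
  proof -
    have "summable (\<lambda>j. \<sigma> (j + k))"
      using sum\<sigma> by (simp add: summable_iff_shift)
    from suminf_split_head[OF this] show ?thesis by (simp add: \<tau>_def)
  qed
  have \<tau>_nonneg: "0 \<le> \<tau> k" for k
    unfolding \<tau>_def using sum\<sigma> \<sigma>_pos by (intro suminf_nonneg) (auto simp: summable_iff_shift less_imp_le)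
  have a_pos: "0 < a k" for k by (simp add: a_def)
  have a_half: "a k \<le> 1 / 2" for k
  proof -
    have "2 \<le> exp (1 :: real)" using exp_ge_add_one_self[of 1] by simp
    also have "\<dots> \<le> exp (6 * L * c ^ k)" using Lc[of k] by simp
    finally have "2 \<le> exp (6 * L * c ^ k)" .
    then show ?thesis by (simp add: a_def exp_minus field_simps)
  qed
  have a_step: "2 * (a k)\<^sup>2 \<le> a (Suc k) * x (Suc k)" for k
  proof -
    have "2 \<le> exp (1 :: real)" using exp_ge_add_one_self[of 1] by simp
    then have "2 * (a k)\<^sup>2 \<le> exp 1 * (a k)\<^sup>2" by (intro mult_right_mono) auto
    also have "\<dots> = exp (1 - 12 * (L * c ^ k))"
      by (simp add: a_def power2_eq_square exp_add[symmetric])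
    also have "\<dots> \<le> exp (- (6 * L * c ^ Suc k) + - (L * c ^ Suc k))"
      using Lc[of k] by (simp add: c_def)
    also have "\<dots> = a (Suc k) * x (Suc k)" by (simp only: a_def x_def exp_add)
    finally show ?thesis .
  qed
  \<comment> \<open>The bound is proved for all levels at once, because level k of the next iterate
    uses levels k and k + 1 of the current one. Its independence of n lets it pass to the
    limit.\<close>
  have "a k \<le> generation_prob \<mu> n t" if "\<tau> k \<le> t" for n k t
    using that
  proof (induction n arbitrary: k t)
    case 0
    then show ?case using a_half[of k] \<tau>_nonneg[of k] by simp
  next
    case (Suc n)
    have "a k + a (Suc k) * F (\<sigma> k) \<le> (LINT s|\<mu>. generation_prob \<mu> n (t - s))"
    proof (rule integral_admissible_ge[OF admissible_generation_prob])
      show "a k \<le> generation_prob \<mu> n t" using Suc by blast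
      fix s assume "s \<le> \<sigma> k"
      then have "\<tau> (Suc k) \<le> t - s" using Suc.prems \<tau>_Suc[of k] by linarith
      then show "a (Suc k) \<le> generation_prob \<mu> n (t - s)" by (rule Suc.IH)
    qed
    moreover have "a (Suc k) * x (Suc k) \<le> a (Suc k) * F (\<sigma> k)"
      using F\<sigma> a_pos by (simp add: mult_left_mono less_imp_le)
    ultimately have "a k + 2 * (a k)\<^sup>2 \<le> (LINT s|\<mu>. generation_prob \<mu> n (t - s))"
      using a_step[of k] by linarith
    then show ?case
      using one_minus_exp_lower[OF less_imp_le[OF a_pos] a_half] by simp
  qed
  then have "a 0 \<le> explosion_prob (\<tau> 0)"
    by (intro LIMSEQ_le_const[OF tendsto_explosion_prob]) auto
  then show ?thesis using a_pos[of 0] \<tau>_nonneg[of 0] by (intro exI[of _ "\<tau> 0"]) auto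
qed

text \<open>
  The integral in the fixed point equation is split at the time \<open>\<tau> (k + 1)\<close> at which the level
  \<open>a (k + 1) = (a k)\<^sup>2 / C\<close> is reached. The part below that level is absorbed by the quadratic term
  on the left, which leaves \<open>F (\<tau> k - \<tau> (k + 1)) \<ge> a k / 4\<close>, up to limits from the right.
\<close>

lemma integral_finite_if_explosion_prob_pos:
  assumes "0 \<le> t\<^sub>0" "explosion_prob t\<^sub>0 > 0"
  shows "\<exists>\<epsilon>>0. (\<integral>\<^sup>+x\<in>{0<..<\<epsilon>}. mu_plus_inv \<mu> x / ennreal (x * \<bar>ln x\<bar>) \<partial>lborel) < \<infinity>"
proof -
  let ?v = explosion_prob
  have v: "0 \<le> ?v t" "?v t \<le> 1" "s \<le> t \<Longrightarrow> ?v s \<le> ?v t" "t < 0 \<Longrightarrow> ?v t = 0" for s t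
    using admissible_explosion_prob by (auto simp: admissible_def mono_def)
  \<comment> \<open>The part \<open>4 * F t\<^sub>0\<close> makes the contribution below the next
    level at most v^2 / 4, half of the available quadratic term. The summand 2 ensures \<theta>
    \<le> 1/2, as v is at most 1.\<close>
  define C where "C = 4 * F t\<^sub>0 + 2"
  define \<theta> where "\<theta> = ?v t\<^sub>0 / C"
  \<comment> \<open>The explicit solution of the recursion
    \<open>a (Suc k) * C = (a k)\<^sup>2\<close> with initial value
    \<open>explosion_prob t\<^sub>0\<close>.\<close>
  define a where "a k = C * \<theta> ^ (2 ^ k)" for k :: nat
  have C: "2 \<le> C" "4 * F t\<^sub>0 \<le> C" by (auto simp: C_def)
  have "?v t\<^sub>0 \<le> C / 2" using v(2)[of t\<^sub>0] C by linarith
  then have \<theta>: "0 < \<theta>" "\<theta> \<le> 1 / 2"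
    using C assms by (auto simp: \<theta>_def field_simps)
  have a_pos: "0 < a k" for k using C \<theta> by (simp add: a_def)
  have a_0: "a 0 = ?v t\<^sub>0" using C by (simp add: a_def \<theta>_def)
  have a_step: "a (Suc k) * C = (a k)\<^sup>2" for k
    by (simp add: a_def power_mult power2_eq_square mult_ac power_mult_distrib power_add[symmetric] mult_2)
  have a_anti: "a (Suc k) \<le> a k" for k
    unfolding a_def using C \<theta> by (intro mult_left_mono power_decreasing[of "2 ^ k"]) auto
  then have a_le: "a k \<le> ?v t\<^sub>0" for k
    using decseqD[OF decseq_SucI[of a], of 0 k] by (simp add: a_0)
  define S where "S k = {t. 0 \<le> t \<and> a k \<le> ?v t}" for k
  \<comment> \<open>Nothing is known about the value of \<open>explosion_prob\<close> at the infimum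
    itself. The estimate \<open>key\<close> is therefore made at elements of \<open>S k\<close>, and
    the infimum is taken only in \<open>step\<close>.\<close>
  define \<tau> where "\<tau> k = Inf (S k)" for k
  have t0: "t\<^sub>0 \<in> S k" for k using assms a_le by (simp add: S_def)
  have bdd: "bdd_below (S k)" for k by (rule bdd_belowI[of _ 0]) (simp add: S_def)
  have \<tau>_nonneg: "0 \<le> \<tau> k" for k
    unfolding \<tau>_def using t0 by (intro cInf_greatest) (auto simp: S_def)
  have \<tau>_le: "\<tau> k \<le> t" if "t \<in> S k" for k t
    unfolding \<tau>_def by (rule cInf_lower[OF that bdd])
  have below: "?v r \<le> a k" if "r < \<tau> k" for r k
  proof (cases "0 \<le> r")
    case True
    then have "r \<notin> S k" using \<tau>_le[of r k] that by auto
    then show ?thesis using True by (simp add: S_def)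
  qed (use v(4) a_pos[of k] in \<open>simp add: not_le less_imp_le\<close>)
  have key: "a k / 4 \<le> F (t - \<tau> (Suc k))" if "t \<in> S k" "t \<le> t\<^sub>0" for t k
  proof -
    let ?b = "\<tau> (Suc k)"
    have t: "0 \<le> t" "a k \<le> ?v t" using that by (auto simp: S_def)
    then have "t \<in> S (Suc k)" using a_anti[of k] by (simp add: S_def)
    then have "?b \<le> t" by (rule \<tau>_le)
    have "?v t + (?v t)\<^sup>2 / 2 \<le> (LINT s|\<mu>. ?v (t - s))"
      using explosion_prob_fixed_point v(1) by (rule one_minus_exp_upper)
    also have "\<dots> \<le> ?v t + ?v t * F (t - ?b) + a (Suc k) * F t"
      using below \<open>?b \<le> t\<close> \<tau>_nonneg a_pos
      by (intro integral_admissible_le[OF admissible_explosion_prob]) (auto simp: less_imp_le)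
    finally have 1: "(?v t)\<^sup>2 / 2 \<le> ?v t * F (t - ?b) + a (Suc k) * F t" by simp
    have "4 * F t \<le> C" using F_mono[OF that(2)] C by linarith
    then have "a (Suc k) * (4 * F t) \<le> a (Suc k) * C"
      using a_pos[of "Suc k"] by (intro mult_left_mono) auto
    also have "\<dots> = (a k)\<^sup>2" by (rule a_step)
    also have "\<dots> \<le> (?v t)\<^sup>2" using t a_pos[of k] by (intro power_mono) auto
    finally have "(?v t)\<^sup>2 / 4 \<le> ?v t * F (t - ?b)" using 1 by simp
    then have "?v t * (?v t / 4) \<le> ?v t * F (t - ?b)" by (simp add: power2_eq_square)
    then have "?v t / 4 \<le> F (t - ?b)" using t a_pos[of k] by (simp add: mult_le_cancel_left)
    then show ?thesis using t by simp
  qed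
  define \<phi> where "\<phi> k = enn2real (mu_plus_inv \<mu> (a k / 4))" for k
  have \<phi>_le: "mu_plus_inv \<mu> (a k / 4) \<le> ennreal (t - \<tau> (Suc k))" "\<phi> k \<le> t - \<tau> (Suc k)" if "t \<in> S k" "t \<le> t\<^sub>0" for k t
  proof -
    have "t \<in> S (Suc k)" using that a_anti[of k] by (simp add: S_def)
    then have "0 \<le> t - \<tau> (Suc k)" using \<tau>_le by fastforce
    then show "mu_plus_inv \<mu> (a k / 4) \<le> ennreal (t - \<tau> (Suc k))"
      using key[OF that] by (rule mu_plus_inv_le)
    with \<open>0 \<le> t - \<tau> (Suc k)\<close> show "\<phi> k \<le> t - \<tau> (Suc k)"
      unfolding \<phi>_def by (rule enn2real_leI)
  qed
  have \<phi>: "mu_plus_inv \<mu> (a k / 4) = ennreal (\<phi> k)" for k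
    using \<phi>_le(1)[OF t0 order_refl, of k] by (auto simp: \<phi>_def ennreal_enn2real_if top_unique)
  have step: "\<phi> k \<le> \<tau> k - \<tau> (Suc k)" for k
  proof -
    have "\<phi> k + \<tau> (Suc k) \<le> \<tau> k" unfolding \<tau>_def[of k]
    proof (rule cInf_greatest)
      \<comment> \<open>Times beyond \<open>t\<^sub>0\<close>, where the bound on \<open>F t\<close>
        fails to be at hand, inherit the inequality from \<open>t\<^sub>0\<close>, itself an element
        of \<open>S k\<close>.\<close>
      fix t assume "t \<in> S k"
      then show "\<phi> k + \<tau> (Suc k) \<le> t"
        using \<phi>_le(2)[of t k] \<phi>_le(2)[OF t0[of k] order_refl] by (cases "t \<le> t\<^sub>0") auto
    qed (use t0 in auto)
    then show ?thesis by simp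
  qed
  have part: "(\<Sum>k<n. \<phi> k) \<le> t\<^sub>0" for n
  proof -
    have "(\<Sum>k<n. \<phi> k) \<le> (\<Sum>k<n. \<tau> k - \<tau> (Suc k))"
      by (intro sum_mono step)
    also have "\<dots> = \<tau> 0 - \<tau> n" by (rule sum_lessThan_telescope')
    also have "\<dots> \<le> t\<^sub>0" using \<tau>_nonneg[of n] \<tau>_le[OF t0, of 0] by linarith
    finally show ?thesis .
  qed
  have "(\<Sum>k. mu_plus_inv \<mu> (a k / 4)) \<le> ennreal t\<^sub>0"
    unfolding \<phi>
  proof (rule suminf_le_const)
    show "(\<Sum>k<n. ennreal (\<phi> k)) \<le> ennreal t\<^sub>0" for n
      using part[of n] by (subst sum_ennreal) (auto simp: \<phi>_def intro: ennreal_leI)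
  qed simp
  \<comment> \<open>This makes exp (- L 2^k) equal to (\<theta> / 2)^(2^k), which is at most
    \<theta>^(2^k) / 2 and hence at most \<open>a k / 4\<close>, because C \<ge> 2.\<close>
  define L where "L = - ln (\<theta> / 2)"
  have L: "0 < L" using \<theta> by (simp add: L_def)
  have x: "exp (- (L * 2 ^ k)) \<le> a k / 4" for k :: nat
  proof -
    have "exp (- (L * 2 ^ k)) = exp (ln (\<theta> / 2)) ^ (2 ^ k)"
      unfolding exp_of_nat_mult[symmetric] by (simp add: L_def mult.commute)
    also have "\<dots> = \<theta> ^ (2 ^ k) * (1 / 2) ^ (2 ^ k)"
      using \<theta> by (simp add: power_divide)
    also have "\<dots> \<le> \<theta> ^ (2 ^ k) * (1 / 2) ^ 1"
      using \<theta> by (intro mult_left_mono power_decreasing[of 1]) auto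
    also have "\<dots> \<le> a k / 4" using C \<theta> by (simp add: a_def field_simps)
    finally show ?thesis .
  qed
  have "(\<integral>\<^sup>+y\<in>{0<..<exp (- (L * 2 ^ 0))}. mu_plus_inv \<mu> y / ennreal (y * \<bar>ln y\<bar>) \<partial>lborel)
    \<le> (\<Sum>k::nat. mu_plus_inv \<mu> (exp (- (L * 2 ^ k)))) * ennreal (ln 2)"
    using L by (intro nn_integral_log_scale_bounds(1) mono_mu_plus_inv measurable_mu_plus_inv) auto
  also have "\<dots> \<le> (\<Sum>k. mu_plus_inv \<mu> (a k / 4)) * ennreal (ln 2)"
    by (intro mult_right_mono suminf_le monoD[OF mono_mu_plus_inv] x) auto
  also have "\<dots> \<le> ennreal t\<^sub>0 * ennreal (ln 2)"
    by (rule mult_right_mono) (fact, simp)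
  also have "\<dots> < \<infinity>" by (simp add: ennreal_mult_less_top)
  finally show ?thesis by (intro exI[of _ "exp (- (L * 2 ^ 0))"]) simp
qed

end

section \<open>First generation decomposition\<close>

lemma labels_Nil [simp]: "[] \<in> labels" and labels_snoc [simp]: "u @ [j] \<in> labels \<longleftrightarrow> u \<in> labels \<and> 1 \<le> j"
  and labels_Cons [simp]: "j # u \<in> labels \<longleftrightarrow> u \<in> labels \<and> 1 \<le> j"
  by (auto simp: labels_def)

text \<open>The newest generation stands first in a label, so the ancestor in the first generation
  is its last letter and the subtree of child j is the family
  \<open>\<lambda>w. x (w @ [j])\<close>.\<close>

lemma birth_time_snoc:
  "birth_time x (u @ [j]) = point_time (x []) j + birth_time (\<lambda>w. x (w @ [j])) u"
  by (induction u) (auto simp: add.assoc)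

lemma measurable_birth_time:
  assumes "\<And>v. v \<in> labels \<Longrightarrow> y v \<in> measurable N point_measure_algebra" "u \<in> labels"
  shows "(\<lambda>\<omega>. birth_time (\<lambda>v. y v \<omega>) u) \<in> borel_measurable N"
  using assms(2)
proof (induction u)
  case (Cons j u)
  then have [measurable]: "y u \<in> measurable N point_measure_algebra"
    "(\<lambda>\<omega>. birth_time (\<lambda>v. y v \<omega>) u) \<in> borel_measurable N"
    using assms by auto
  show ?case by simp
qed simp

text \<open>Only births up to time t count: generation n may still have members that are born
  later.\<close>

definition extinct :: "(nat list \<Rightarrow> real measure) \<Rightarrow> nat \<Rightarrow> real \<Rightarrow> bool" where
  "extinct x n t \<longleftrightarrow> (\<forall>u\<in>{u \<in> labels. length u = n}. \<not> birth_time x u \<le> ennreal t)"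

lemma measurable_extinct:
  assumes "\<And>v. v \<in> labels \<Longrightarrow> y v \<in> measurable N point_measure_algebra"
  shows "Measurable.pred N (\<lambda>\<omega>. extinct (\<lambda>v. y v \<omega>) n t)"
  unfolding extinct_def
proof (intro pred_intros_countable_bounded countableI_type)
  fix u assume "u \<in> {u \<in> labels. length u = n}"
  then have [measurable]: "(\<lambda>\<omega>. birth_time (\<lambda>v. y v \<omega>) u) \<in> borel_measurable N"
    by (intro measurable_birth_time assms) auto
  show "Measurable.pred N (\<lambda>\<omega>. \<not> birth_time (\<lambda>v. y v \<omega>) u \<le> ennreal t)"
    by measurable
qed

lemma extinct_cong:
  assumes "\<And>w. w \<in> labels \<Longrightarrow> x w = y w"
  shows "extinct x n t \<longleftrightarrow> extinct y n t"
proof -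
  have "birth_time x u = birth_time y u" if "u \<in> labels" for u
    using that assms by (induction u) auto
  then show ?thesis by (auto simp: extinct_def)
qed

lemma extinct_Suc:
  assumes "extinct x n t"
  shows "extinct x (Suc n) t"
  unfolding extinct_def
proof (intro ballI)
  fix u assume "u \<in> {u \<in> labels. length u = Suc n}"
  then obtain j v where u: "u = j # v" "v \<in> labels" "length v = n" by (cases u) auto
  then have "\<not> birth_time x v \<le> ennreal t" using assms by (auto simp: extinct_def)
  moreover have "birth_time x v \<le> birth_time x u" using u by simp
  ultimately show "\<not> birth_time x u \<le> ennreal t" by (meson order.trans)
qed

text \<open>Subtraction takes place in the reals. The default
  \<open>enn2real \<infinity> = 0\<close> does no harm, since the first conjunct excludes an
  infinite p.\<close>

lemma ennreal_add_le_iff: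
  assumes "0 \<le> t"
  shows "p + b \<le> ennreal t \<longleftrightarrow> p \<le> ennreal t \<and> b \<le> ennreal (t - enn2real p)"
  using assms by (cases p; cases b) (auto simp: ennreal_le_iff2 top_unique simp flip: ennreal_plus)

lemma extinct_Suc_iff:
  assumes "0 \<le> t"
  shows "extinct x (Suc n) t \<longleftrightarrow>
    (\<forall>j\<in>points_upto (x []) t. extinct (\<lambda>w. x (w @ [j])) n (t - enn2real (point_time (x []) j)))"
proof -
  have "{u \<in> labels. length u = Suc n} = (\<lambda>(w, j). w @ [j]) ` ({w \<in> labels. length w = n} \<times> {1..})"
  proof (intro set_eqI iffI)
    fix u assume "u \<in> {u \<in> labels. length u = Suc n}"
    then show "u \<in> (\<lambda>(w, j). w @ [j]) ` ({w \<in> labels. length w = n} \<times> {1..})"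
      by (cases u rule: rev_cases) auto
  qed auto
  then show ?thesis
    unfolding extinct_def points_upto_def
    by (simp add: birth_time_snoc ennreal_add_le_iff[OF assms]) auto
qed

text \<open>Finite offspring in bounded time keeps each generation finite up to time t, so an
  infinite population must reach every generation. Conversely, members of all generations have
  labels of all lengths.\<close>

lemma infinite_population_iff:
  assumes x: "\<And>u. u \<in> labels \<Longrightarrow> x u \<in> point_measures \<and> locally_finite (x u)" and t: "0 \<le> t"
  shows "infinite {u \<in> labels. birth_time x u \<le> ennreal t} \<longleftrightarrow> (\<forall>n. \<not> extinct x n t)"
proof
  let ?G = "\<lambda>n. {u \<in> labels. length u = n \<and> birth_time x u \<le> ennreal t}"
  assume inf: "infinite {u \<in> labels. birth_time x u \<le> ennreal t}"
  show "\<forall>n. \<not> extinct x n t"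
  proof (rule ccontr)
    assume "\<not> (\<forall>n. \<not> extinct x n t)"
    then obtain n where n: "extinct x n t" by blast
    have ext: "extinct x k t" if "n \<le> k" for k
      using that by (induction rule: dec_induct) (auto intro: n extinct_Suc)
    have fin: "finite (?G k)" for k
    proof (induction k)
      case (Suc k)
      have "?G (Suc k) \<subseteq> (\<Union>u\<in>?G k. (\<lambda>j. j # u) ` points_upto (x u) t)"
      proof
        fix u assume u: "u \<in> ?G (Suc k)"
        then obtain j v where v: "u = j # v" "v \<in> labels" "length v = k" "1 \<le> j"
          by (cases u) auto
        have "birth_time x v + point_time (x v) j \<le> ennreal t" using u v by simp
        then have "birth_time x v \<le> ennreal t" "point_time (x v) j \<le> ennreal t"
          by (auto intro: order.trans[rotated])
        then show "u \<in> (\<Union>u\<in>?G k. (\<lambda>j. j # u) ` points_upto (x u) t)"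
          using v by (auto simp: points_upto_def)
      qed
      moreover have "finite (points_upto (x u) t)" if "u \<in> ?G k" for u
        using that x t by (auto intro: finite_points_upto)
      ultimately show ?case using Suc by (meson finite_UN_I finite_imageI finite_subset)
    qed (auto intro: finite_subset[of _ "{[]}"])
    have "{u \<in> labels. birth_time x u \<le> ennreal t} \<subseteq> (\<Union>k<n. ?G k)"
    proof
      fix u assume u: "u \<in> {u \<in> labels. birth_time x u \<le> ennreal t}"
      then have "\<not> extinct x (length u) t" by (auto simp: extinct_def)
      then have "length u < n" using ext by (meson not_le)
      then show "u \<in> (\<Union>k<n. ?G k)" using u by auto
    qed
    then have "finite {u \<in> labels. birth_time x u \<le> ennreal t}"
      using fin by (meson finite_UN_I finite_lessThan finite_subset)
    with inf show False by blast
  qed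
next
  assume *: "\<forall>n. \<not> extinct x n t"
  have "n \<in> length ` {u \<in> labels. birth_time x u \<le> ennreal t}" for n
  proof -
    obtain u where "u \<in> labels" "length u = n" "birth_time x u \<le> ennreal t"
      using *[rule_format, of n] by (auto simp: extinct_def)
    then show ?thesis by blast
  qed
  then have "length ` {u \<in> labels. birth_time x u \<le> ennreal t} = UNIV" by blast
  then show "infinite {u \<in> labels. birth_time x u \<le> ennreal t}"
    using finite_imageI infinite_UNIV_nat by metis
qed

text \<open>The subtree of a child is again an i.i.d. family. The family is reindexed by restricting
  it to the disjoint singletons \<open>{w @ [j]}\<close> and then evaluating.\<close>

lemma iid_copies_shift:
  assumes "prob_space P" "iid_copies P \<Xi> M \<xi>" "1 \<le> j"
  shows "iid_copies P (\<lambda>w. \<Xi> (w @ [j])) M \<xi>"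
proof -
  interpret P: prob_space P by fact
  have ind: "P.indep_vars (\<lambda>_. point_measure_algebra) \<Xi> labels"
    and law: "\<And>u. u \<in> labels \<Longrightarrow> distr P point_measure_algebra (\<Xi> u) = distr M point_measure_algebra \<xi>"
    using assms by (auto simp: iid_copies_def)
  have "P.indep_vars (\<lambda>w. PiM {w @ [j]} (\<lambda>_. point_measure_algebra)) (\<lambda>w \<omega>. \<lambda>i\<in>{w @ [j]}. \<Xi> i \<omega>) labels"
    using assms(3) by (intro P.indep_vars_restrict[OF ind]) (auto simp: disjoint_family_on_def)
  then have "P.indep_vars (\<lambda>_. point_measure_algebra) (\<lambda>w \<omega>. (\<lambda>i\<in>{w @ [j]}. \<Xi> i \<omega>) (w @ [j])) labels"
    by (rule P.indep_vars_compose2[where Y="\<lambda>w y. y (w @ [j])"]) (rule measurable_component_singleton, simp)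
  then show ?thesis using law assms(3) by (simp add: iid_copies_def)
qed

text \<open>Subtrees of different children use disjoint sets of labels and are therefore
  independent. The empty J is separate because the product rule requires a nonempty index
  set.\<close>

lemma prob_all_extinct:
  assumes "prob_space P" "iid_copies P \<Xi> M \<xi>" and J: "finite J" "J \<subseteq> {1..}"
  shows "measure P {\<omega> \<in> space P. \<forall>j\<in>J. extinct (\<lambda>w. \<Xi> (w @ [j]) \<omega>) n (t j)}
    = (\<Prod>j\<in>J. measure P {\<omega> \<in> space P. extinct (\<lambda>w. \<Xi> (w @ [j]) \<omega>) n (t j)})"
proof (cases "J = {}")
  interpret P: prob_space P by fact
  case True
  then show ?thesis by (simp add: P.prob_space)
next
  interpret P: prob_space P by fact
  case False
  have ind: "P.indep_vars (\<lambda>_. point_measure_algebra) \<Xi> labels"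
    using assms by (simp add: iid_copies_def)
  define K where "K j = (\<lambda>w. w @ [j]) ` labels" for j
  define Y where "Y j \<omega> = (\<lambda>i\<in>K j. \<Xi> i \<omega>)" for j \<omega>
  define A where "A j = {y \<in> space (PiM (K j) (\<lambda>_. point_measure_algebra)). extinct (\<lambda>w. y (w @ [j])) n (t j)}" for j
  have indY: "P.indep_vars (\<lambda>j. PiM (K j) (\<lambda>_. point_measure_algebra)) Y J"
    unfolding Y_def using J by (intro P.indep_vars_restrict[OF ind]) (auto simp: K_def disjoint_family_on_def)
  have A: "A j \<in> sets (PiM (K j) (\<lambda>_. point_measure_algebra))" for j
    unfolding A_def pred_def[symmetric]
    by (rule measurable_extinct[where y="\<lambda>v y. y (v @ [j])"], rule measurable_component_singleton) (simp add: K_def)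
  have Y: "Y j \<omega> (w @ [j]) = \<Xi> (w @ [j]) \<omega>" if "w \<in> labels" for w j \<omega>
    using that by (simp add: Y_def K_def)
  have Y': "Y j -` A j \<inter> space P = {\<omega> \<in> space P. extinct (\<lambda>w. \<Xi> (w @ [j]) \<omega>) n (t j)}" if "j \<in> J" for j
  proof -
    have "Y j \<in> measurable P (PiM (K j) (\<lambda>_. point_measure_algebra))"
      using indY that by (simp add: P.indep_vars_def)
    then have "Y j \<omega> \<in> space (PiM (K j) (\<lambda>_. point_measure_algebra))" if "\<omega> \<in> space P" for \<omega>
      using that by (rule measurable_space)
    then show ?thesis using extinct_cong[OF Y] by (auto simp: A_def)
  qed
  have "{\<omega> \<in> space P. \<forall>j\<in>J. extinct (\<lambda>w. \<Xi> (w @ [j]) \<omega>) n (t j)} = (\<Inter>j\<in>J. Y j -` A j \<inter> space P)"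
    using Y' False by auto
  then show ?thesis
    using P.indep_varsD_finite[OF indY False J(1) A] by (simp add: Y')
qed

section \<open>Identification of the solution with the explosion probability\<close>

locale critical_poisson = prob_space M + critical_intensity \<mu> for M :: "'a measure" and \<mu> +
  fixes \<xi> :: "'a \<Rightarrow> real measure"
  assumes reproduction: "reproduction_process M \<xi>"
    and poisson: "poisson_point_process M \<xi> \<mu>"
begin

text \<open>Given the points of the root, the subtrees are independent and each has to miss
  generation n within its remaining time; the generating functional averages the resulting product.
  The family is arbitrary in the induction, since the hypothesis is applied to the subtrees.\<close>

lemma prob_extinct:
  assumes P: "prob_space P" and "iid_copies P \<Xi> M \<xi>" "0 \<le> t"
  shows "measure P {\<omega> \<in> space P. extinct (\<lambda>u. \<Xi> u \<omega>) n t} = 1 - generation_prob \<mu> n t"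
  using assms(2,3)
proof (induction n arbitrary: \<Xi> t)
  case 0
  then show ?case by (simp add: extinct_def)
next
  case (Suc n)
  note iid = \<open>iid_copies P \<Xi> M \<xi>\<close>
  interpret P: prob_space P by fact
  have ind: "P.indep_vars (\<lambda>_. point_measure_algebra) \<Xi> labels"
    and law: "distr P point_measure_algebra (\<Xi> []) = distr M point_measure_algebra \<xi>"
    using iid by (auto simp: iid_copies_def)
  have \<Xi>: "\<Xi> u \<in> measurable P point_measure_algebra" if "u \<in> labels" for u
    using ind that by (simp add: P.indep_vars_def)
  have \<xi>: "\<xi> \<in> measurable M point_measure_algebra"
    using reproduction by (simp add: reproduction_process_def)
  define L where "L = labels - {[]}"
  define R where "R \<omega> = (\<lambda>u\<in>L. \<Xi> u \<omega>)" for \<omega>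
  let ?A = "point_measure_algebra" and ?B = "PiM L (\<lambda>_. point_measure_algebra)"
  \<comment> \<open>Glues a root measure to the processes of all other labels, so that the event
    lives on a product space and the root can be integrated out by Fubini.\<close>
  define x where "x m y u = (if u = [] then m else y u)" for m :: "real measure" and y and u :: "nat list"
  define E where "E = {p \<in> space (?A \<Otimes>\<^sub>M ?B). extinct (x (fst p) (snd p)) (Suc n) t}"
  have E: "E \<in> sets (?A \<Otimes>\<^sub>M ?B)"
    unfolding E_def pred_def[symmetric]
  proof (rule measurable_extinct)
    fix v assume v: "v \<in> labels"
    show "(\<lambda>p. x (fst p) (snd p) v) \<in> measurable (?A \<Otimes>\<^sub>M ?B) ?A"
    proof (cases "v = []")
      case False
      then have [measurable]: "(\<lambda>y. y v) \<in> measurable ?B ?A"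
        using v by (intro measurable_component_singleton) (simp add: L_def)
      show ?thesis using False by (simp add: x_def)
    qed (simp add: x_def)
  qed
  \<comment> \<open>\<open>indep_var\<close> needs two variables of the same type, so \<open>\<Xi> []\<close> is wrapped into a family.\<close>
  define X where "X \<omega> = (\<lambda>u\<in>{[]}. \<Xi> u \<omega>)" for \<omega>
  let ?C = "PiM {[]} (\<lambda>_. point_measure_algebra)"
  have "P.indep_var ?C X ?B R"
    unfolding X_def R_def by (rule P.indep_var_restrict[OF ind]) (auto simp: L_def)
  then have X: "X \<in> measurable P ?C" and R: "R \<in> measurable P ?B"
    and XR0: "distr P ?C X \<Otimes>\<^sub>M distr P ?B R = distr P (?C \<Otimes>\<^sub>M ?B) (\<lambda>\<omega>. (X \<omega>, R \<omega>))"
    unfolding P.indep_var_distribution_eq by auto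
  interpret R: prob_space "distr P ?B R" by (rule P.prob_space_distr[OF R])
  have joint: "distr P ?A (\<Xi> []) \<Otimes>\<^sub>M distr P ?B R = distr P (?A \<Otimes>\<^sub>M ?B) (\<lambda>\<omega>. (\<Xi> [] \<omega>, R \<omega>))"
  proof -
    have ev: "(\<lambda>z. z []) \<in> measurable ?C ?A"
      by (rule measurable_component_singleton) simp
    have "distr P ?A (\<Xi> []) \<Otimes>\<^sub>M distr P ?B R
      = distr (distr P ?C X) ?A (\<lambda>z. z []) \<Otimes>\<^sub>M distr (distr P ?B R) ?B (\<lambda>y. y)"
      using X R ev by (simp add: distr_distr comp_def X_def)
    also have "\<dots> = distr (distr P ?C X \<Otimes>\<^sub>M distr P ?B R) (?A \<Otimes>\<^sub>M ?B) (\<lambda>(z, y). (z [], y))"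
      using ev R by (intro pair_measure_distr)
        (auto simp: distr_distr comp_def intro!: prob_space_imp_sigma_finite P.prob_space_distr)
    also have "\<dots> = distr P (?A \<Otimes>\<^sub>M ?B) (\<lambda>\<omega>. (\<Xi> [] \<omega>, R \<omega>))"
    proof -
      have "(\<lambda>\<omega>. (X \<omega>, R \<omega>)) \<in> measurable P (?C \<Otimes>\<^sub>M ?B)"
        using X R by simp
      then show ?thesis unfolding XR0 using ev by (subst distr_distr) (auto simp: comp_def X_def)
    qed
    finally show ?thesis .
  qed
  have xR: "x (\<Xi> [] \<omega>) (R \<omega>) u = \<Xi> u \<omega>" if "u \<in> labels" for u \<omega>
    using that by (auto simp: x_def R_def L_def)
  have XR: "(\<lambda>\<omega>. (\<Xi> [] \<omega>, R \<omega>)) \<in> measurable P (?A \<Otimes>\<^sub>M ?B)"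
    using \<Xi>[of "[]"] R by simp
  have slice: "emeasure (distr P ?B R) (Pair (\<xi> \<omega>') -` E)
      = ennreal (\<Prod>j\<in>points_upto (\<xi> \<omega>') t. 1 - generation_prob \<mu> n (t - enn2real (point_time (\<xi> \<omega>') j)))"
    if "\<xi> \<omega>' \<in> point_measures" "locally_finite (\<xi> \<omega>')" for \<omega>'
  proof -
    let ?m = "\<xi> \<omega>'"
    let ?J = "points_upto ?m t"
    let ?s = "\<lambda>j. t - enn2real (point_time ?m j)"
    have J: "finite ?J" "?J \<subseteq> {1..}"
      using finite_points_upto that Suc.prems by (auto simp: points_upto_def)
    have "emeasure (distr P ?B R) (Pair ?m -` E) = emeasure P (R -` (Pair ?m -` E) \<inter> space P)"
      using R E by (intro emeasure_distr) (auto intro: sets_Pair1)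
    also have "R -` (Pair ?m -` E) \<inter> space P = {\<omega> \<in> space P. \<forall>j\<in>?J. extinct (\<lambda>w. \<Xi> (w @ [j]) \<omega>) n (?s j)}"
    proof -
      have "R \<omega> \<in> Pair ?m -` E \<longleftrightarrow> (\<forall>j\<in>?J. extinct (\<lambda>w. \<Xi> (w @ [j]) \<omega>) n (?s j))" if "\<omega> \<in> space P" for \<omega>
      proof -
        have "R \<omega> \<in> space ?B" using R that by (rule measurable_space)
        then have "R \<omega> \<in> Pair ?m -` E \<longleftrightarrow> extinct (x ?m (R \<omega>)) (Suc n) t"
          using \<open>?m \<in> point_measures\<close> by (simp add: E_def space_pair_measure)
        also have "\<dots> \<longleftrightarrow> (\<forall>j\<in>?J. extinct (\<lambda>w. x ?m (R \<omega>) (w @ [j])) n (?s j))"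
          unfolding extinct_Suc_iff[OF Suc.prems(2)] by (simp add: x_def)
        also have "\<dots> \<longleftrightarrow> (\<forall>j\<in>?J. extinct (\<lambda>w. \<Xi> (w @ [j]) \<omega>) n (?s j))"
          using J by (intro ball_cong refl extinct_cong) (auto simp: x_def R_def L_def)
        finally show ?thesis .
      qed
      then show ?thesis by auto
    qed
    also have "emeasure P \<dots> = ennreal (\<Prod>j\<in>?J. measure P {\<omega> \<in> space P. extinct (\<lambda>w. \<Xi> (w @ [j]) \<omega>) n (?s j)})"
      unfolding P.emeasure_eq_measure by (subst prob_all_extinct[OF P iid J]) simp
    also have "(\<Prod>j\<in>?J. measure P {\<omega> \<in> space P. extinct (\<lambda>w. \<Xi> (w @ [j]) \<omega>) n (?s j)}) = (\<Prod>j\<in>?J. 1 - generation_prob \<mu> n (?s j))"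
    proof (rule prod.cong[OF refl])
      fix j assume j: "j \<in> ?J"
      then have "0 \<le> ?s j" using Suc.prems by (auto simp: points_upto_def intro: enn2real_leI)
      then show "measure P {\<omega> \<in> space P. extinct (\<lambda>w. \<Xi> (w @ [j]) \<omega>) n (?s j)} = 1 - generation_prob \<mu> n (?s j)"
        using j by (intro Suc.IH iid_copies_shift[OF P iid]) (auto simp: points_upto_def)
    qed
    finally show ?thesis .
  qed
  have "emeasure P {\<omega> \<in> space P. extinct (\<lambda>u. \<Xi> u \<omega>) (Suc n) t}
      = emeasure P ((\<lambda>\<omega>. (\<Xi> [] \<omega>, R \<omega>)) -` E \<inter> space P)"
    using extinct_cong[OF xR] measurable_space[OF XR] by (intro arg_cong[where f="emeasure P"]) (auto simp: E_def)
  also have "\<dots> = emeasure (distr P ?A (\<Xi> []) \<Otimes>\<^sub>M distr P ?B R) E"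
    unfolding joint using XR E by (simp add: emeasure_distr)
  also have "\<dots> = (\<integral>\<^sup>+m. emeasure (distr P ?B R) (Pair m -` E) \<partial>distr M ?A \<xi>)"
    unfolding law[symmetric] using E by (intro R.emeasure_pair_measure_alt) simp
  also have "\<dots> = (\<integral>\<^sup>+\<omega>'. emeasure (distr P ?B R) (Pair (\<xi> \<omega>') -` E) \<partial>M)"
    using E by (intro nn_integral_distr \<xi> R.measurable_emeasure_Pair) (simp cong: sets_pair_measure_cong)
  also have "\<dots> = (\<integral>\<^sup>+\<omega>'. ennreal (\<Prod>j\<in>points_upto (\<xi> \<omega>') t. 1 - generation_prob \<mu> n (t - enn2real (point_time (\<xi> \<omega>') j))) \<partial>M)"
    using reproduction_process_locally_finite[OF reproduction]
    by (intro nn_integral_cong_AE, elim eventually_mono) (simp add: slice)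
  also have "\<dots> = ennreal (exp (- (LINT s:{0..t}|\<mu>. 1 - (1 - generation_prob \<mu> n (t - s)))))"
  proof (rule poisson_generating_functional[OF _ reproduction poisson Suc.prems(2)])
    show "prob_space M" by (rule prob_space_axioms)
    have "(\<lambda>s. generation_prob \<mu> n (t - s)) \<in> borel_measurable half_line"
      using measurable_reflected[OF admissible_borel_measurable[OF admissible_generation_prob]]
      unfolding measurable_cong_sets[OF sets_mu refl] .
    then show "(\<lambda>s. 1 - generation_prob \<mu> n (t - s)) \<in> borel_measurable half_line"
      by measurable
  qed (use admissible_generation_prob[of n] in \<open>auto simp: admissible_def\<close>)
  \<comment> \<open>Beyond t the integrand vanishes by the value 0 at negative times.\<close>
  also have "(LINT s:{0..t}|\<mu>. 1 - (1 - generation_prob \<mu> n (t - s))) = (LINT s|\<mu>. generation_prob \<mu> n (t - s))"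
    unfolding set_lebesgue_integral_def using admissible_generation_prob[of n]
    by (intro Bochner_Integration.integral_cong refl) (auto simp: indicator_def space_mu admissible_def)
  finally show ?case by (simp add: P.emeasure_eq_measure)
qed

text \<open>The population is infinite at time t with probability \<open>explosion_prob t\<close>.
  These events increase with t, so explosion is their union over integer times, which is null
  exactly if all of them are.\<close>

lemma explosive_cmj_iff:
  assumes P: "prob_space P" and iid: "iid_copies P \<Xi> M \<xi>"
  shows "explosive_cmj P \<Xi> \<longleftrightarrow> (\<exists>t\<ge>0. explosion_prob t > 0)"
proof -
  interpret P: prob_space P by fact
  have \<Xi>: "\<Xi> u \<in> measurable P point_measure_algebra" if "u \<in> labels" for u
    using iid that by (simp add: iid_copies_def P.indep_vars_def)
  have law: "distr P point_measure_algebra (\<Xi> u) = distr M point_measure_algebra \<xi>" if "u \<in> labels" for u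
    using iid that by (simp add: iid_copies_def)
  have \<xi>: "\<xi> \<in> measurable M point_measure_algebra"
    using reproduction by (simp add: reproduction_process_def)
  let ?S = "\<lambda>\<omega> t. {u \<in> labels. birth_time (\<lambda>v. \<Xi> v \<omega>) u \<le> ennreal t}"
  define A where "A t = {\<omega> \<in> space P. infinite (?S \<omega> t)}" for t
  have lf: "AE \<omega> in P. \<forall>u\<in>labels. \<Xi> u \<omega> \<in> point_measures \<and> locally_finite (\<Xi> u \<omega>)"
  proof (subst AE_ball_countable[OF countableI_type], intro ballI)
    fix u assume u: "u \<in> labels"
    have pred: "{m \<in> space point_measure_algebra. m \<in> point_measures \<and> locally_finite m} \<in> sets point_measure_algebra"
      using measurable_locally_finite by simp
    have "AE m in distr M point_measure_algebra \<xi>. m \<in> point_measures \<and> locally_finite m"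
      using reproduction_process_locally_finite[OF reproduction] by (subst AE_distr_iff[OF \<xi> pred])
    then show "AE \<omega> in P. \<Xi> u \<omega> \<in> point_measures \<and> locally_finite (\<Xi> u \<omega>)"
      unfolding law[OF u, symmetric] by (subst (asm) AE_distr_iff[OF \<Xi>[OF u] pred])
  qed
  have A: "A t \<in> sets P" for t
  proof -
    \<comment> \<open>Numbering the labels turns infinitude into unboundedness, a condition with
      countable quantifiers.\<close>
    have inf: "infinite S \<longleftrightarrow> (\<forall>k::nat. \<exists>u\<in>{u \<in> labels. k \<le> to_nat u}. u \<in> S)" if "S \<subseteq> labels" for S
    proof -
      have "infinite S \<longleftrightarrow> infinite (to_nat ` S)" by (simp add: finite_image_iff)
      also have "\<dots> \<longleftrightarrow> (\<forall>k. \<exists>i\<ge>k. i \<in> to_nat ` S)"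
        by (rule infinite_nat_iff_unbounded_le)
      also have "\<dots> \<longleftrightarrow> (\<forall>k. \<exists>u\<in>{u \<in> labels. k \<le> to_nat u}. u \<in> S)"
        using that by fastforce
      finally show ?thesis .
    qed
    have "A t = {\<omega> \<in> space P. \<forall>k::nat. \<exists>u\<in>{u \<in> labels. k \<le> to_nat u}. birth_time (\<lambda>v. \<Xi> v \<omega>) u \<le> ennreal t}"
      unfolding A_def by (subst inf) auto
    also have "\<dots> \<in> sets P"
      unfolding pred_def[symmetric]
    proof (intro pred_intros_countable pred_intros_countable_bounded countableI_type)
      fix k :: nat and u assume "u \<in> {u \<in> labels. k \<le> to_nat u}"
      then have [measurable]: "(\<lambda>\<omega>. birth_time (\<lambda>v. \<Xi> v \<omega>) u) \<in> borel_measurable P"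
        by (intro measurable_birth_time \<Xi>) auto
      show "Measurable.pred P (\<lambda>\<omega>. birth_time (\<lambda>v. \<Xi> v \<omega>) u \<le> ennreal t)"
        by measurable
    qed
    finally show ?thesis .
  qed
  have prob_A: "measure P (A t) = explosion_prob t" if t: "0 \<le> t" for t
  proof -
    define G where "G n = {\<omega> \<in> space P. \<not> extinct (\<lambda>u. \<Xi> u \<omega>) n t}" for n
    have ext: "{\<omega> \<in> space P. extinct (\<lambda>u. \<Xi> u \<omega>) n t} \<in> sets P" for n
      unfolding pred_def[symmetric] by (rule measurable_extinct[OF \<Xi>])
    have G_eq: "G n = space P - {\<omega> \<in> space P. extinct (\<lambda>u. \<Xi> u \<omega>) n t}" for n
      by (auto simp: G_def)
    then have G: "G n \<in> sets P" for n using ext by auto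
    have "measure P (G n) = generation_prob \<mu> n t" for n
      unfolding G_eq using P.prob_compl[OF ext] prob_extinct[OF P iid t] by simp
    moreover have "(\<lambda>n. measure P (G n)) \<longlonglongrightarrow> measure P (\<Inter>n. G n)"
      using G by (intro P.finite_Lim_measure_decseq) (auto simp: G_def intro!: decseq_SucI dest: extinct_Suc)
    ultimately have "measure P (\<Inter>n. G n) = explosion_prob t"
      using LIMSEQ_unique[OF _ tendsto_explosion_prob[of t]] by simp
    moreover have "measure P (A t) = measure P (\<Inter>n. G n)"
    \<comment> \<open>The two events agree only almost surely, namely where all reproduction
      measures are locally finite.\<close>
    proof (rule P.finite_measure_eq_AE)
      show "AE \<omega> in P. \<omega> \<in> A t \<longleftrightarrow> \<omega> \<in> (\<Inter>n. G n)"
        using lf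
      proof eventually_elim
        case (elim \<omega>)
        then show ?case
          using infinite_population_iff[of "\<lambda>u. \<Xi> u \<omega>" t] t by (auto simp: A_def G_def)
      qed
    qed (use A G in auto)
    ultimately show ?thesis by simp
  qed
  have mono_A: "A s \<subseteq> A t" if "s \<le> t" for s t
  proof -
    have "?S \<omega> s \<subseteq> ?S \<omega> t" for \<omega>
      using ennreal_leI[OF that] by (auto intro: order.trans)
    then show ?thesis unfolding A_def using finite_subset by blast
  qed
  have "explosion_time x < \<infinity> \<longleftrightarrow> (\<exists>t\<ge>0. population x t = \<infinity>)" for x
  proof
    assume "explosion_time x < \<infinity>"
    then show "\<exists>t\<ge>0. population x t = \<infinity>"
      unfolding explosion_time_def Inf_less_iff by auto
  next
    assume "\<exists>t\<ge>0. population x t = \<infinity>"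
    then show "explosion_time x < \<infinity>"
      unfolding explosion_time_def Inf_less_iff using ennreal_less_top by (auto simp: infinity_ennreal_def)
  qed
  then have "{\<omega> \<in> space P. explosion_time (\<lambda>u. \<Xi> u \<omega>) < \<infinity>} = {\<omega>. \<exists>t\<ge>0. \<omega> \<in> A t}"
    unfolding A_def population_def by (auto simp: emeasure_count_space split: if_splits)
  also have "\<dots> = (\<Union>n::nat. A (real n))"
  proof (intro set_eqI iffI)
    fix \<omega> assume "\<omega> \<in> {\<omega>. \<exists>t\<ge>0. \<omega> \<in> A t}"
    then obtain t where "\<omega> \<in> A t" by blast
    moreover obtain n :: nat where "t \<le> real n" using real_arch_simple by blast
    ultimately show "\<omega> \<in> (\<Union>n::nat. A (real n))" using mono_A by blast
  qed (auto intro: of_nat_0_le_iff)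
  finally have expl: "explosive_cmj P \<Xi> \<longleftrightarrow> measure P (\<Union>n::nat. A (real n)) > 0"
    by (simp add: explosive_cmj_def)
  show ?thesis
  proof
    assume "explosive_cmj P \<Xi>"
    then have pos: "measure P (\<Union>n::nat. A (real n)) > 0" using expl by simp
    show "\<exists>t\<ge>0. explosion_prob t > 0"
    proof (rule ccontr)
      assume "\<not> (\<exists>t\<ge>0. explosion_prob t > 0)"
      then have "explosion_prob (real n) \<le> 0" for n :: nat by (meson not_le of_nat_0_le_iff)
      then have "A (real n) \<in> null_sets P" for n :: nat
        using A prob_A[of "real n"] by (intro null_setsI) (auto simp: P.emeasure_eq_measure ennreal_eq_0_iff)
      then have "(\<Union>n::nat. A (real n)) \<in> null_sets P" by (rule null_sets_UN)
      then have "measure P (\<Union>n::nat. A (real n)) = 0" by (simp add: measure_def null_setsD1)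
      with pos show False by simp
    qed
  next
    assume "\<exists>t\<ge>0. explosion_prob t > 0"
    then obtain t where t: "0 \<le> t" "explosion_prob t > 0" by blast
    obtain n :: nat where "t \<le> real n" using real_arch_simple by blast
    then have "A t \<subseteq> (\<Union>n::nat. A (real n))" using mono_A by blast
    then have "measure P (A t) \<le> measure P (\<Union>n::nat. A (real n))"
      using A by (intro P.finite_measure_mono) auto
    then show "explosive_cmj P \<Xi>" using expl t prob_A[of t] by simp
  qed
qed

end

theorem theorem2p7:
  fixes M :: "'a measure" and \<xi> :: "'a \<Rightarrow> real measure" and \<mu> :: "real measure"
    and P :: "'b measure" and \<Xi> :: "nat list \<Rightarrow> 'b \<Rightarrow> real measure"
  assumes "prob_space M"
    and "reproduction_process M \<xi>"
    and "poisson_point_process M \<xi> \<mu>"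
    and "emeasure \<mu> {0} = 1"
    and "\<exists>t\<^sub>0>0. mu_plus \<mu> t\<^sub>0 < \<infinity>"
    and "\<forall>t>0. mu_plus \<mu> t > 0"
    and "\<exists>\<delta>>0. convex_on {0..<\<delta>} (\<lambda>t. enn2real (mu_plus \<mu> t))"
    and "prob_space P"
    and "iid_copies P \<Xi> M \<xi>"
  shows "explosive_cmj P \<Xi> \<longleftrightarrow>
    (\<exists>\<epsilon>>0. (\<integral>\<^sup>+x\<in>{0<..<\<epsilon>}. mu_plus_inv \<mu> x / ennreal (x * \<bar>ln x\<bar>) \<partial>lborel) < \<infinity>)"
proof -
  interpret M: prob_space M by fact
  interpret critical_poisson M \<mu> \<xi>
  proof
    show "sets \<mu> = sets half_line" using assms(3) by (simp add: poisson_point_process_def)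
    show "emeasure \<mu> {0..t} < \<infinity>" if "0 \<le> t" for t
      using poisson_intensity_locally_finite[OF assms(1-3) that] .
  qed fact+
  show ?thesis
    unfolding explosive_cmj_iff[OF assms(8,9)]
    using explosion_prob_pos integral_finite_if_explosion_prob_pos by blast
qed

end
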